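(* Let $\theta\in(0,1)$ be irrational with $\theta^2=1/m$ for some $m\in\mathbb{N}_+$. For $\gamma_\theta$-almost every $x\in[0,\theta]$, \[ \lim_{n\to\infty}\frac{S_{n,\theta}(x)-L_{n,\theta}(x)}{n\log n}=\frac{1}{\log(1+\theta^2)}. \]
   Context: Let $m\in\mathbb{N}_+$ not be a perfect square and $\theta=1/\sqrt m\in(0,1)$ (so $\theta$ is irrational and $\theta^2=1/m$). The map $T_\theta:[0,\theta]\to[0,\theta]$ is $T_\theta(x)=\frac1x-\theta\lfloor\frac{1}{\theta x}\rfloor$ for $x\in(0,\theta]$ and $T_\theta(0)=0$. The digits of $x$ are $\ell_n(x)=\lfloor \frac{1}{\theta T_\theta^{n-1}(x)}\rfloor$ for $n\ge1$ (with $T_\theta^0(x)=x$); they take values in $\{m,m+1,\dots\}$ and are defined for almost every $x$. The probability measure $\gamma_\theta$ on $[0,\theta]$ has density $\frac{1}{\log(1+\theta^2)}\cdot\frac{\theta}{1+\theta x}$ with respect to Lebesgue measure; it is $T_\theta$-invariant and ergodic. Define $S_{n,\theta}(x)=\sum_{k=1}^n\ell_k(x)$ and $L_{n,\theta}(x)=\max_{1\le k\le n}\ell_k(x)$. *)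

theory Defs
  imports "HOL-Probability.Probability"
begin

definition T_theta :: "real \<Rightarrow> real \<Rightarrow> real" where
  "T_theta \<theta> x = (if x = 0 then 0 else 1 / x - \<theta> * of_int \<lfloor>1 / (\<theta> * x)\<rfloor>)"

definition digit :: "real \<Rightarrow> nat \<Rightarrow> real \<Rightarrow> int" where
  "digit \<theta> n x = \<lfloor>1 / (\<theta> * (T_theta \<theta> ^^ (n - 1)) x)\<rfloor>"

definition S_theta :: "real \<Rightarrow> nat \<Rightarrow> real \<Rightarrow> real" where
  "S_theta \<theta> n x = (\<Sum>k = 1..n. real_of_int (digit \<theta> k x))"

definition L_theta :: "real \<Rightarrow> nat \<Rightarrow> real \<Rightarrow> real" where
  "L_theta \<theta> n x = real_of_int (Max ((\<lambda>k. digit \<theta> k x) ` {1..n}))"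

definition gamma_theta :: "real \<Rightarrow> real measure" where
  "gamma_theta \<theta> = density lborel
     (\<lambda>x. ennreal (indicator {0..\<theta>} x * (\<theta> / (ln (1 + \<theta>\<^sup>2) * (1 + \<theta> * x)))))"

end

theory Submission
  imports Defs "HOL-Real_Asymp.Real_Asymp"
begin

text \<open>
  The transfer operator \<open>gauss_op\<close> of \<open>T_theta\<close> with respect to the invariant measure maps increasing
  functions to decreasing ones and shrinks their oscillation by the factor \<open>1 / (m + 1)\<close>. Applied to
  the indicators of \<open>{first_digit \<ge> s}\<close>, whose images under the operator are explicit and of size
  \<open>O(1 / s)\<close>, this gives exponentially small covariances. Following Diamond and Vaaler, the sum of the
  digits truncated slightly above \<open>n\<close> then has variance small enough for almost sure convergence
  along a subsequence, while almost surely, for large \<open>n\<close>, at most one of the first \<open>n\<close> digits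
  exceeds the truncation level; removing the largest digit therefore changes the sum to the truncated
  one up to a negligible error.
\<close>

text \<open>The obstacle is that the digits have infinite mean: \<open>first_digit\<close> reaches s
  with probability of order 1/s, so a single digit can be as large as the normalisation itself.
  Truncation at level t leaves mean ln t / \<kappa> + O(1) and second moment O(t). For t of size n
  up to powers of ln n, the sum of n truncated digits has mean asymptotic to n ln n / \<kappa>,
  which is the origin of the limit. The level is pulled in two directions: the relative variance, of
  order t / (n (ln n)^2), asks for a small t, and the expected number of pairs of digits above t, of
  order n^2 / t^2, asks for a large one. Exponential decay of covariances alone is too weak here:
  summing over all thresholds s and u up to t would cost a factor t^2. A prefactor of order 1 / (s
  u) is needed, and it comes from applying the transfer operator once to the indicator before
  monotonicity is used.\<close>

text \<open>By Tonelli the series of the \<open>f n\<close> has finite integral, so it converges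
  almost everywhere and its terms tend to 0. This does the work of Chebyshev plus Borel-Cantelli,
  both for the variances and for the counts of large pairs.\<close>

lemma AE_tendsto_zero_if_summable_integral:
  fixes f :: "nat \<Rightarrow> 'a \<Rightarrow> real"
  assumes int: "\<And>n. integrable M (f n)" and nonneg: "\<And>n x. 0 \<le> f n x"
    and summable: "summable (\<lambda>n. integral\<^sup>L M (f n))"
  shows "AE x in M. (\<lambda>n. f n x) \<longlonglongrightarrow> 0"
proof -
  have [measurable]: "f n \<in> borel_measurable M" for n using int[of n] by auto
  have eq: "(\<integral>\<^sup>+x. ennreal (f n x) \<partial>M) = ennreal (integral\<^sup>L M (f n))" for n
    by (rule nn_integral_eq_integral[OF int]) (simp add: nonneg)
  have pos: "0 \<le> integral\<^sup>L M (f n)" for n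
    by (rule integral_nonneg_AE) (simp add: nonneg)
  have "(\<integral>\<^sup>+x. (\<Sum>n. ennreal (f n x)) \<partial>M) = (\<Sum>n. \<integral>\<^sup>+x. ennreal (f n x) \<partial>M)"
    by (rule nn_integral_suminf) measurable
  also have "\<dots> = (\<Sum>n. ennreal (integral\<^sup>L M (f n)))"
    by (simp only: eq)
  also have "\<dots> \<noteq> \<infinity>"
    using ennreal_suminf_neq_top[OF summable pos] by (simp only: infinity_ennreal_def not_False_eq_True)
  finally have "AE x in M. (\<Sum>n. ennreal (f n x)) \<noteq> \<infinity>"
    by (intro nn_integral_PInf_AE) auto
  then show ?thesis
  proof (rule AE_mp, intro AE_I2 impI)
    fix x assume "(\<Sum>n. ennreal (f n x)) \<noteq> \<infinity>"
    then have "summable (\<lambda>n. f n x)"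
      using nonneg by (intro summable_suminf_not_top) auto
    then show "(\<lambda>n. f n x) \<longlonglongrightarrow> 0" by (rule summable_LIMSEQ_zero)
  qed
qed

text \<open>Each step adds at most 2 + 1. The crude linear bound suffices, since it only has to
  match the second moment of a digit truncated at n, which is linear in n as well.\<close>

lemma harmonic_sum_square_le:
  "(\<Sum>s=1..n. 1 / real s)\<^sup>2 \<le> 3 * real n"
proof (induction n)
  case (Suc n)
  let ?H = "\<Sum>s=1..n. 1 / real s"
  have H: "?H \<le> real n" using sum_mono[of "{1..n}" "\<lambda>s. 1 / real s" "\<lambda>_. 1"] by simp
  then have "2 * ?H * (1 / real (Suc n)) \<le> 2" by (simp add: field_simps)
  moreover have "(1 / real (Suc n))\<^sup>2 \<le> 1" by (simp add: power_le_one)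
  moreover have "(\<Sum>s=1..Suc n. 1 / real s)\<^sup>2 = ?H\<^sup>2 + 2 * ?H * (1 / real (Suc n)) + (1 / real (Suc n))\<^sup>2"
    by (simp add: power2_sum)
  ultimately show ?case using Suc by simp
qed simp

text \<open>Only a maximal value can reach t, so truncation changes no other term. Keeping
  \<open>min\<close> around the maximum covers the case in which no value reaches t.\<close>

lemma sum_diff_Max_eq:
  fixes X :: "nat \<Rightarrow> real"
  assumes "0 < n" and unique: "\<And>i k. i < k \<Longrightarrow> k < n \<Longrightarrow> X i < t \<or> X k < t"
  shows "(\<Sum>k<n. X k) - Max (X ` {..<n}) = (\<Sum>k<n. min (X k) t) - min (Max (X ` {..<n})) t"
proof -
  have "Max (X ` {..<n}) \<in> X ` {..<n}" using assms by (intro Max_in) auto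
  then obtain i where i: "i < n" "Max (X ` {..<n}) = X i" by auto
  have "X k < t" if k: "k < n" "k \<noteq> i" for k
  proof (rule ccontr)
    assume "\<not> X k < t"
    moreover have "X k \<le> X i" using k i(2)[symmetric] by (simp add: Max_ge)
    ultimately show False using unique[of i k] unique[of k i] k i(1) by linarith
  qed
  then have "(\<Sum>k\<in>{..<n} - {i}. X k) = (\<Sum>k\<in>{..<n} - {i}. min (X k) t)"
    by (intro sum.cong refl) (auto simp: min_absorb1 less_imp_le)
  then show ?thesis using i by (simp add: sum.remove[of "{..<n}" i])
qed

subsection \<open>Block endpoints and truncation levels\<close>

text \<open>The blocks \<open>block j \<le> n < block (Suc j)\<close> have ratio of endpoints tending to \<open>1\<close>, yet are sparse
  enough for the second-moment bounds to be summable over \<open>j\<close>; within a block, all digits are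
  truncated at the same \<open>cutoff j\<close>. The summability bounds are of order \<open>j powr (a - 2 * b)\<close> and
  \<open>j powr (- 2 * a)\<close> for the exponents \<open>b = 9/10\<close> and \<open>a = 3/5\<close>.\<close>

definition endpoint :: "nat \<Rightarrow> real" where "endpoint j = exp (real j powr (9/10))"
definition block :: "nat \<Rightarrow> nat" where "block j = nat \<lfloor>endpoint j\<rfloor>"
definition cutoff :: "nat \<Rightarrow> nat" where "cutoff j = Suc (nat \<lfloor>endpoint j * real j powr (3/5)\<rfloor>)"
text \<open>Since \<open>j powr (9/10)\<close> is the logarithm of \<open>endpoint j\<close>, this
  is N ln N at N = \<open>endpoint j\<close>, the normalisation of the theorem.\<close>

definition growth :: "nat \<Rightarrow> real" where "growth j = endpoint j * real j powr (9/10)"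

lemma real_block: "real (block j) = of_int \<lfloor>exp (real j powr (9/10))\<rfloor>"
  by (simp add: block_def endpoint_def of_nat_nat)

lemma real_cutoff: "real (cutoff j) = of_int \<lfloor>exp (real j powr (9/10)) * real j powr (3/5)\<rfloor> + 1"
  by (simp add: cutoff_def endpoint_def of_nat_nat)

text \<open>In terms of the exponents, convergence of the series asks for 2b - a > 1 and 2a > 1, a
  negligible cutoff for a < b, and merging block endpoints for b < 1. The choice b = 9/10, a = 3/5
  meets all four and makes both rates equal to -6/5.\<close>

lemma summable_if_bigo_powr:
  assumes "f \<in> O(\<lambda>j. real j powr (-6/5))" shows "summable (f :: nat \<Rightarrow> real)"
  by (rule summable_comparison_test_bigo[OF _ assms]) (auto simp: summable_real_powr_iff)

lemma summable_variance_bounds: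
  "summable (\<lambda>j. real (block j) * real (cutoff j) / (growth j)\<^sup>2)"
  "summable (\<lambda>j. real (block (Suc j)) * real (cutoff j) / (growth j)\<^sup>2)"
  "summable (\<lambda>j. (real (block (Suc j)))\<^sup>2 / (real (cutoff j))\<^sup>2)"
proof -
  have "(\<lambda>j. real (block j) * real (cutoff j) / (growth j)\<^sup>2) \<in> O(\<lambda>j. real j powr (-6/5))"
    unfolding real_cutoff real_block growth_def endpoint_def by real_asymp
  then show "summable (\<lambda>j. real (block j) * real (cutoff j) / (growth j)\<^sup>2)"
    by (rule summable_if_bigo_powr)
  have "(\<lambda>j. real (block (Suc j)) * real (cutoff j) / (growth j)\<^sup>2) \<in> O(\<lambda>j. real j powr (-6/5))"
    unfolding real_cutoff real_block growth_def endpoint_def by real_asymp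
  then show "summable (\<lambda>j. real (block (Suc j)) * real (cutoff j) / (growth j)\<^sup>2)"
    by (rule summable_if_bigo_powr)
  have "(\<lambda>j. (real (block (Suc j)))\<^sup>2 / (real (cutoff j))\<^sup>2) \<in> O(\<lambda>j. real j powr (-6/5))"
    unfolding real_cutoff real_block growth_def endpoint_def by real_asymp
  then show "summable (\<lambda>j. (real (block (Suc j)))\<^sup>2 / (real (cutoff j))\<^sup>2)"
    by (rule summable_if_bigo_powr)
qed

text \<open>Both ends of a block are compared with the same \<open>growth j\<close>. For the right
  end this rests on (j+1)^b - j^b tending to 0, hence on b < 1.\<close>

lemma block_asymp:
  "(\<lambda>j. real (block j) / endpoint j) \<longlonglongrightarrow> 1"
  "(\<lambda>j. real (block (Suc j)) / endpoint j) \<longlonglongrightarrow> 1"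
  "(\<lambda>j. growth j / (real (block j) * ln (real (block j)))) \<longlonglongrightarrow> 1"
  "(\<lambda>j. growth j / (real (block (Suc j)) * ln (real (block (Suc j))))) \<longlonglongrightarrow> 1"
  unfolding real_block growth_def endpoint_def by real_asymp+

text \<open>The first limit gives the mean of a truncated digit, up to the factor 1 / \<kappa>; the
  second makes the loss of one truncated maximum negligible.\<close>

lemma cutoff_asymp:
  "(\<lambda>j. ln (real (cutoff j) + 1) / real j powr (9/10)) \<longlonglongrightarrow> 1"
  "(\<lambda>j. real (cutoff j) / growth j) \<longlonglongrightarrow> 0"
  unfolding real_cutoff growth_def endpoint_def by real_asymp+

lemma cutoff_at_top: "filterlim cutoff at_top sequentially"
proof -
  have "filterlim (\<lambda>j. real (cutoff j)) at_top sequentially"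
    unfolding real_cutoff by real_asymp
  then show ?thesis by (simp add: filterlim_sequentially_iff_filterlim_real)
qed

lemma block_at_top: "filterlim block at_top sequentially"
proof -
  have "filterlim (\<lambda>j. real (block j)) at_top sequentially"
    unfolding real_block by real_asymp
  then show ?thesis by (simp add: filterlim_sequentially_iff_filterlim_real)
qed

lemma mono_block: "mono block"
  unfolding block_def endpoint_def by (intro monoI nat_mono floor_mono) (simp add: powr_mono2)

lemma block_0: "block 0 = 1"
  by (simp add: block_def endpoint_def)

lemma ex_block:
  assumes "1 \<le> n" obtains j where "block j \<le> n" "n < block (Suc j)"
proof -
  have "\<forall>\<^sub>F J in sequentially. Suc n \<le> block J"
    using block_at_top by (simp add: filterlim_at_top)
  then obtain J where "n < block J"
    by (metis Suc_le_lessD eventually_happens' sequentially_bot)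
  define i where "i = (LEAST i. n < block i)"
  have i: "n < block i" unfolding i_def by (rule LeastI) fact
  then have "i \<noteq> 0" using assms block_0 by (intro notI) simp
  then obtain j where j: "i = Suc j" using not0_implies_Suc by blast
  have "\<not> n < block j" using not_less_Least[of j "\<lambda>i. n < block i"] j by (simp add: i_def)
  then show ?thesis using that[of j] i j by simp
qed

subsection \<open>The transfer operator\<close>

locale theta_expansion =
  fixes \<theta> :: real and m :: nat
  assumes m_pos: "0 < m" and theta_pos: "0 < \<theta>" and theta_sq: "\<theta>\<^sup>2 = 1 / real m"
begin

abbreviation "M \<equiv> gamma_theta \<theta>"
abbreviation "T \<equiv> T_theta \<theta>"

definition \<kappa> :: real where "\<kappa> = ln (1 + \<theta>\<^sup>2)"

definition first_digit :: "real \<Rightarrow> int" where "first_digit x = \<lfloor>1 / (\<theta> * x)\<rfloor>"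

text \<open>The inverse branch of \<open>T\<close> belonging to first digit \<open>m + j\<close>;
  the shift by m lets the index start at 0.\<close>

definition branch :: "nat \<Rightarrow> real \<Rightarrow> real" where
  "branch j x = 1 / (\<theta> * real (m + j) + x)"

text \<open>The conditional probability, given that \<open>T\<close> takes the value x, that the
  first digit is \<open>m + j\<close>. Equivalently, invariant density at the preimage times
  Jacobian, divided by the density at x.\<close>

definition weight :: "nat \<Rightarrow> real \<Rightarrow> real" where
  "weight j x = (1 + \<theta> * x) / ((\<theta> * real (m + j) + x) * (\<theta> * real (m + Suc j) + x))"

text \<open>The closed form of the sum of \<open>weight j x\<close> over \<open>j \<ge> k\<close>:
  the conditional probability of a first digit of at least \<open>m + k\<close>.\<close>

definition weight_tail :: "nat \<Rightarrow> real \<Rightarrow> real" where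
  "weight_tail k x = (1 + \<theta> * x) / (1 + real k * \<theta>\<^sup>2 + \<theta> * x)"

text \<open>The transfer operator normalised by the invariant density, so that constants are fixed:
  the conditional expectation of g given the value x of \<open>T\<close>.\<close>

definition gauss_op :: "(real \<Rightarrow> real) \<Rightarrow> real \<Rightarrow> real" where
  "gauss_op g x = (\<Sum>j. weight j x * g (branch j x))"

lemma kappa_pos: "0 < \<kappa>"
  unfolding \<kappa>_def using theta_pos by (intro ln_gt_zero) auto

lemma m_theta: "\<theta> * real m = 1 / \<theta>" "\<theta> * (\<theta> * real m) = 1"
  using theta_sq theta_pos m_pos by (auto simp: field_simps power2_eq_square)

lemma sets_M [simp, measurable_cong]: "sets M = sets borel"
  and space_M [simp]: "space M = UNIV"
  by (simp_all add: gamma_theta_def)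

lemma measurable_T [measurable]: "T \<in> borel_measurable borel"
  unfolding T_theta_def[abs_def] by measurable

lemma measurable_first_digit [measurable]: "first_digit \<in> measurable borel (count_space UNIV)"
  unfolding first_digit_def[abs_def] by measurable

lemma measurable_branch [measurable]: "branch j \<in> borel_measurable borel"
  unfolding branch_def[abs_def] by measurable

lemma measurable_weight [measurable]: "weight j \<in> borel_measurable borel"
  unfolding weight_def[abs_def] by measurable

lemma measurable_gauss_op [measurable]:
  assumes [measurable]: "g \<in> borel_measurable borel"
  shows "gauss_op g \<in> borel_measurable borel"
  unfolding gauss_op_def[abs_def] by measurable

lemma measurable_T_pow [measurable]: "(T ^^ n) \<in> borel_measurable borel"
  by (induction n) (auto intro: measurable_compose[OF _ measurable_T] simp: o_def)

lemma denominator_pos: "0 \<le> x \<Longrightarrow> 0 < \<theta> * real (m + j) + x"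
  using m_pos theta_pos by (intro add_pos_nonneg mult_pos_pos) auto

lemma branch_pos: "0 \<le> x \<Longrightarrow> 0 < branch j x"
  using denominator_pos[of x j] by (simp add: branch_def)

lemma branch_le: "0 \<le> x \<Longrightarrow> branch j x \<le> \<theta>"
proof -
  assume "0 \<le> x"
  have "branch j x \<le> 1 / (\<theta> * real m)"
    unfolding branch_def using \<open>0 \<le> x\<close> theta_pos m_pos denominator_pos[of x j]
    by (intro divide_left_mono mult_pos_pos) (auto simp: algebra_simps)
  then show ?thesis by (simp add: m_theta(1))
qed

lemma branch_antimono: "0 \<le> x \<Longrightarrow> x \<le> y \<Longrightarrow> branch j y \<le> branch j x"
  unfolding branch_def using denominator_pos[of x j] denominator_pos[of y j]
  by (intro divide_left_mono) auto

lemma branch_Suc: "branch (Suc j) 0 = branch j \<theta>"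
  by (simp add: branch_def algebra_simps)

text \<open>The strict bound matters: \<open>branch j \<theta>\<close> is the endpoint shared with
  the next cylinder and has digit \<open>m + j + 1\<close>. For this reason later identities are
  stated almost everywhere, on the open interval.\<close>

lemma first_digit_branch:
  assumes "0 \<le> x" "x < \<theta>" shows "first_digit (branch j x) = int (m + j)"
proof -
  have "1 / (\<theta> * branch j x) = real (m + j) + x / \<theta>"
    using theta_pos denominator_pos[OF assms(1), of j] by (simp add: branch_def field_simps)
  moreover have "0 \<le> x / \<theta>" "x / \<theta> < 1" using assms theta_pos by auto
  ultimately show ?thesis unfolding first_digit_def by linarith
qed

lemma T_branch:
  assumes "0 \<le> x" "x < \<theta>" shows "T (branch j x) = x"
  using first_digit_branch[OF assms, of j] branch_pos[OF assms(1), of j]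
  unfolding T_theta_def first_digit_def by (simp add: branch_def)

lemma T_range: "0 \<le> x \<Longrightarrow> x \<le> \<theta> \<Longrightarrow> T x \<in> {0..<\<theta>}"
proof -
  assume x: "0 \<le> x" "x \<le> \<theta>"
  show ?thesis
  proof (cases "x = 0")
    case False
    define r where "r = 1 / (\<theta> * x)"
    have "T x = \<theta> * (r - of_int \<lfloor>r\<rfloor>)"
      using False theta_pos by (simp add: T_theta_def r_def right_diff_distrib)
    moreover have "0 \<le> r - of_int \<lfloor>r\<rfloor>" "r - of_int \<lfloor>r\<rfloor> < 1" by linarith+
    ultimately show ?thesis using theta_pos by simp
  qed (use theta_pos in \<open>simp add: T_theta_def\<close>)
qed

section \<open>The invariant measure and the change of variables along inverse branches\<close>

lemma nn_integral_M:
  assumes [measurable]: "f \<in> borel_measurable borel"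
  shows "(\<integral>\<^sup>+x. f x \<partial>M) =
    (\<integral>\<^sup>+x. ennreal (\<theta> / (\<kappa> * (1 + \<theta> * x))) * f x * indicator {0..\<theta>} x \<partial>lborel)"
  unfolding gamma_theta_def \<kappa>_def
  by (subst nn_integral_density) (auto intro!: nn_integral_cong split: split_indicator)

lemma AE_M_range: "AE x in M. x \<in> {0..\<theta>}"
  unfolding gamma_theta_def by (subst AE_density) (auto split: split_indicator)

lemma AE_M_range_open: "AE x in M. x \<in> {0<..<\<theta>}"
proof -
  have "AE x in lborel. x \<noteq> 0" "AE x in lborel. x \<noteq> \<theta>" by (rule AE_lborel_singleton)+
  then show ?thesis
    unfolding gamma_theta_def by (subst AE_density) (auto split: split_indicator)
qed

text \<open>The density has primitive ln (1 + \<theta> x) / \<kappa>. Taking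
  \<open>a = \<theta>\<close> gives total mass 1, and \<open>a = 1 / (\<theta> * s)\<close> gives
  the law of the first digit.\<close>

lemma emeasure_M_Icc:
  assumes "0 \<le> a" "a \<le> \<theta>"
  shows "emeasure M {0..a} = ennreal (ln (1 + \<theta> * a) / \<kappa>)"
proof -
  have "emeasure M {0..a} = (\<integral>\<^sup>+x. indicator {0..a} x \<partial>M)"
    by simp
  also have "\<dots> = (\<integral>\<^sup>+x. ennreal (\<theta> / (\<kappa> * (1 + \<theta> * x))) * indicator {0..a} x \<partial>lborel)"
    by (subst nn_integral_M)
      (use assms in \<open>auto intro!: nn_integral_cong split: split_indicator\<close>)
  also have "\<dots> = ennreal (ln (1 + \<theta> * a) / \<kappa> - ln (1 + \<theta> * 0) / \<kappa>)"
  proof (rule nn_integral_FTC_Icc)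
    fix x assume x: "x \<in> {0..a}"
    then have p: "1 + \<theta> * x > 0" using theta_pos by (intro add_pos_nonneg) auto
    then have "((\<lambda>x. ln (1 + \<theta> * x)) has_real_derivative \<theta> / (1 + \<theta> * x)) (at x)"
      by (auto intro!: derivative_eq_intros)
    from DERIV_cdivide[OF this, of \<kappa>]
    show "((\<lambda>x. ln (1 + \<theta> * x) / \<kappa>) has_real_derivative \<theta> / (\<kappa> * (1 + \<theta> * x))) (at x)"
      by (simp add: mult.commute)
    show "0 \<le> \<theta> / (\<kappa> * (1 + \<theta> * x))" using p kappa_pos theta_pos by simp
  qed (use assms in auto)
  finally show ?thesis by simp
qed

lemma prob_space_M: "prob_space M"
proof
  have "emeasure M (space M) = emeasure M {0..\<theta>}"
    by (rule emeasure_eq_AE) (use AE_M_range in auto)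
  also have "\<dots> = 1"
    using emeasure_M_Icc[of \<theta>] theta_pos kappa_pos by (simp add: \<kappa>_def power2_eq_square)
  finally show "emeasure M (space M) = 1" .
qed

text \<open>A branch is decreasing, so the reflection of x to -x is inserted to obtain an increasing
  substitution, whose derivative is \<open>(branch j x)\<^sup>2\<close>.\<close>

lemma nn_integral_branch:
  fixes F :: "real \<Rightarrow> ennreal"
  assumes [measurable]: "F \<in> borel_measurable borel"
  shows "(\<integral>\<^sup>+x. F x * indicator {branch j \<theta>..branch j 0} x \<partial>lborel) =
    (\<integral>\<^sup>+y. F (branch j y) * ennreal ((branch j y)\<^sup>2) * indicator {0..\<theta>} y \<partial>lborel)"
proof -
  have "(\<integral>\<^sup>+x. F x * indicator {branch j \<theta>..branch j 0} x \<partial>lborel) =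
     (\<integral>\<^sup>+x. F (- x) * indicator {- branch j 0..- branch j \<theta>} x \<partial>lborel)"
    by (subst nn_integral_real_affine[where c = "-1" and t = 0])
      (auto intro!: nn_integral_cong split: split_indicator)
  also have "\<dots> = (\<integral>\<^sup>+y. F (- (- branch j y)) * ennreal ((branch j y)\<^sup>2) * indicator {0..\<theta>} y \<partial>lborel)"
  proof (rule nn_integral_substitution_aux)
    fix x assume "x \<in> {0..\<theta>}"
    then have "\<theta> * real (m + j) + x > 0" by (intro denominator_pos) auto
    then show "((\<lambda>y. - branch j y) has_real_derivative (branch j x)\<^sup>2) (at x)"
      unfolding branch_def by (auto intro!: derivative_eq_intros simp: field_simps power2_eq_square)
  next
    show "continuous_on {0..\<theta>} (\<lambda>x. (branch j x)\<^sup>2)"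
      unfolding branch_def
      by (intro continuous_intros ballI) (metis atLeastAtMost_iff denominator_pos less_irrefl)
  qed (use theta_pos in auto)
  finally show ?thesis by simp
qed

text \<open>With d = 1 / \<open>branch j x\<close>, the density at the preimage contributes d / (d +
  \<theta>), which turns the Jacobian 1 / d^2 into 1 / (d (d + \<theta>)).\<close>

lemma density_branch:
  assumes "0 \<le> x"
  shows "\<theta> / (\<kappa> * (1 + \<theta> * branch j x)) * (branch j x)\<^sup>2 = \<theta> / (\<kappa> * (1 + \<theta> * x)) * weight j x"
proof -
  define d where "d = \<theta> * real (m + j) + x"
  have d: "d > 0" using denominator_pos[OF assms] by (simp add: d_def)
  have x: "1 + \<theta> * x > 0" using theta_pos assms by (intro add_pos_nonneg) auto
  have e: "branch j x = 1 / d" "weight j x = (1 + \<theta> * x) / (d * (d + \<theta>))"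
    by (simp_all add: branch_def weight_def d_def algebra_simps)
  have "1 + \<theta> * (1 / d) = (d + \<theta>) / d" using d by (simp add: field_simps)
  then have "\<theta> / (\<kappa> * (1 + \<theta> * (1 / d))) * (1 / d)\<^sup>2 = \<theta> / (\<kappa> * (d * (d + \<theta>)))"
    using d by (simp add: power2_eq_square mult_ac)
  then show ?thesis using x by (simp add: e)
qed

lemma first_digit_eq_iff:
  assumes "0 < x"
  shows "first_digit x = int (m + j) \<longleftrightarrow> x \<in> {branch j \<theta><..branch j 0}"
proof -
  have e: "branch j \<theta> = 1 / (\<theta> * (real (m + j) + 1))" "branch j 0 = 1 / (\<theta> * real (m + j))"
    by (simp_all add: branch_def algebra_simps)
  have p: "0 < real (m + j)" using m_pos by simp
  have "first_digit x = int (m + j) \<longleftrightarrow> real (m + j) \<le> 1 / (\<theta> * x) \<and> 1 / (\<theta> * x) < real (m + j) + 1"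
    unfolding first_digit_def by (simp add: floor_eq_iff)
  also have "real (m + j) \<le> 1 / (\<theta> * x) \<longleftrightarrow> x \<le> branch j 0"
    unfolding e using assms theta_pos p by (simp only: le_divide_eq mult_pos_pos if_True mult_ac)
  also have "1 / (\<theta> * x) < real (m + j) + 1 \<longleftrightarrow> branch j \<theta> < x"
    unfolding e using assms theta_pos p by (simp only: divide_less_eq mult_pos_pos if_True mult_ac add_pos_pos zero_less_one)
  finally show ?thesis by auto
qed

lemma first_digit_ge:
  assumes "0 < x" "x \<le> \<theta>" shows "int m \<le> first_digit x"
proof -
  have "\<theta> * x \<le> \<theta> * \<theta>" using assms theta_pos by simp
  also have "\<dots> = 1 / real m" using theta_sq by (simp add: power2_eq_square)
  finally have "real m \<le> 1 / (\<theta> * x)" using assms theta_pos m_pos by (simp add: field_simps)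
  then show ?thesis unfolding first_digit_def by (simp add: le_floor_iff)
qed

text \<open>Duality of the transfer operator with composition by \<open>T\<close>: cut the interval
  into cylinders and substitute the inverse branch on each. Working in \<open>ennreal\<close> makes
  the exchange of sum and integral free of summability conditions.\<close>

lemma nn_integral_transfer:
  fixes g \<phi> :: "real \<Rightarrow> ennreal"
  assumes [measurable]: "g \<in> borel_measurable borel" "\<phi> \<in> borel_measurable borel"
  shows "(\<integral>\<^sup>+x. g x * \<phi> (T x) \<partial>M) =
    (\<integral>\<^sup>+x. (\<Sum>j. ennreal (weight j x) * g (branch j x)) * \<phi> x \<partial>M)"
proof -
  let ?h = "\<lambda>x. ennreal (\<theta> / (\<kappa> * (1 + \<theta> * x)))"
  define I where "I j = {branch j \<theta><..branch j 0}" for j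
  have piece: "(\<integral>\<^sup>+x. ?h x * (g x * \<phi> (T x)) * indicator (I j) x \<partial>lborel) =
     (\<integral>\<^sup>+x. ?h x * (ennreal (weight j x) * g (branch j x) * \<phi> x) * indicator {0..\<theta>} x \<partial>lborel)" for j
  proof -
    have "AE x in lborel. x \<noteq> branch j \<theta>" by (rule AE_lborel_singleton)
    then have "(\<integral>\<^sup>+x. ?h x * (g x * \<phi> (T x)) * indicator (I j) x \<partial>lborel) =
       (\<integral>\<^sup>+x. (?h x * (g x * \<phi> (T x))) * indicator {branch j \<theta>..branch j 0} x \<partial>lborel)"
      by (intro nn_integral_cong_AE) (auto simp: I_def split: split_indicator)
    also have "\<dots> = (\<integral>\<^sup>+y. (?h (branch j y) * (g (branch j y) * \<phi> (T (branch j y)))) *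
        ennreal ((branch j y)\<^sup>2) * indicator {0..\<theta>} y \<partial>lborel)"
      by (rule nn_integral_branch) measurable
    also have "\<dots> = (\<integral>\<^sup>+x. ?h x * (ennreal (weight j x) * g (branch j x) * \<phi> x) * indicator {0..\<theta>} x \<partial>lborel)"
    proof (rule nn_integral_cong_AE)
      have "AE x in lborel. x \<noteq> \<theta>" by (rule AE_lborel_singleton)
      then show "AE y in lborel. (?h (branch j y) * (g (branch j y) * \<phi> (T (branch j y)))) *
        ennreal ((branch j y)\<^sup>2) * indicator {0..\<theta>} y =
        ?h y * (ennreal (weight j y) * g (branch j y) * \<phi> y) * indicator {0..\<theta>} y"
      proof (rule AE_mp, intro AE_I2 impI)
        fix y assume "y \<noteq> \<theta>"
        show "(?h (branch j y) * (g (branch j y) * \<phi> (T (branch j y)))) *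
          ennreal ((branch j y)\<^sup>2) * indicator {0..\<theta>} y =
          ?h y * (ennreal (weight j y) * g (branch j y) * \<phi> y) * indicator {0..\<theta>} y"
        proof (cases "y \<in> {0..\<theta>}")
          case True
          then have y: "0 \<le> y" "y < \<theta>" using \<open>y \<noteq> \<theta>\<close> by auto
          have "?h (branch j y) * ennreal ((branch j y)\<^sup>2) = ?h y * ennreal (weight j y)"
            using density_branch[OF y(1), of j] theta_pos kappa_pos y(1)
            by (simp add: ennreal_mult''[symmetric] weight_def)
          then show ?thesis using T_branch[OF y, of j] by (simp add: mult_ac)
        qed simp
      qed
    qed
    finally show ?thesis .
  qed
  have cover: "(\<Sum>j. indicator (I j) x) = (indicator {0<..\<theta>} x :: ennreal)" for x
  proof (cases "x \<in> {0<..\<theta>}")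
    case True
    then have x: "0 < x" "x \<le> \<theta>" by auto
    \<comment> \<open>The natural subtraction is exact, because digits on this interval are at least
      m.\<close>
    define i where "i = nat (first_digit x) - m"
    have "x \<in> I j \<longleftrightarrow> j = i" for j
      using first_digit_eq_iff[OF x(1), of j] first_digit_ge[OF x] m_pos
      by (auto simp: I_def i_def)
    then have "(\<lambda>j. indicator (I j) x :: ennreal) = (\<lambda>j. if j = i then 1 else 0)"
      by (auto simp: fun_eq_iff)
    then show ?thesis using True sums_single[of i "\<lambda>_. 1::ennreal", THEN sums_unique] by simp
  next
    case False
    have "x \<notin> I j" for j
      using False branch_pos[of \<theta> j] branch_le[of 0 j] theta_pos by (auto simp: I_def)
    then show ?thesis using False by simp
  qed
  have "(\<integral>\<^sup>+x. g x * \<phi> (T x) \<partial>M) =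
      (\<integral>\<^sup>+x. ?h x * (g x * \<phi> (T x)) * indicator {0..\<theta>} x \<partial>lborel)"
    by (rule nn_integral_M) measurable
  also have "\<dots> = (\<integral>\<^sup>+x. (\<Sum>j. ?h x * (g x * \<phi> (T x)) * indicator (I j) x) \<partial>lborel)"
  proof (rule nn_integral_cong_AE)
    have "AE x in lborel. x \<noteq> (0::real)" by (rule AE_lborel_singleton)
    then show "AE x in lborel. ?h x * (g x * \<phi> (T x)) * indicator {0..\<theta>} x =
        (\<Sum>j. ?h x * (g x * \<phi> (T x)) * indicator (I j) x)"
      by (rule AE_mp, intro AE_I2) (auto simp: cover split: split_indicator)
  qed
  also have "\<dots> = (\<Sum>j. \<integral>\<^sup>+x. ?h x * (g x * \<phi> (T x)) * indicator (I j) x \<partial>lborel)"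
    by (rule nn_integral_suminf) (simp add: I_def)
  also have "\<dots> = (\<integral>\<^sup>+x. (\<Sum>j. ?h x * (ennreal (weight j x) * g (branch j x) * \<phi> x) * indicator {0..\<theta>} x) \<partial>lborel)"
    unfolding piece by (rule nn_integral_suminf[symmetric]) measurable
  also have "\<dots> = (\<integral>\<^sup>+x. ?h x * ((\<Sum>j. ennreal (weight j x) * g (branch j x)) * \<phi> x) * indicator {0..\<theta>} x \<partial>lborel)"
    by (intro nn_integral_cong) simp
  also have "\<dots> = (\<integral>\<^sup>+x. (\<Sum>j. ennreal (weight j x) * g (branch j x)) * \<phi> x \<partial>M)"
    by (rule nn_integral_M[symmetric]) measurable
  finally show ?thesis .
qed

section \<open>Summation of the weights and monotonicity of the transfer operator\<close>

lemma weight_nonneg: "0 \<le> x \<Longrightarrow> 0 \<le> weight j x"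
  using denominator_pos[of x j] denominator_pos[of x "Suc j"] theta_pos
  unfolding weight_def by (intro divide_nonneg_pos mult_pos_pos add_nonneg_nonneg) auto

lemma weight_tail_alt:
  assumes "0 \<le> x"
  shows "weight_tail k x = (1 + \<theta> * x) / (\<theta> * (\<theta> * real (m + k) + x))"
  using theta_pos by (simp add: weight_tail_def algebra_simps m_theta power2_eq_square)

text \<open>Partial fractions: consecutive denominators differ by \<theta>, so the weights telescope
  and all their sums are explicit.\<close>

lemma weight_eq_diff:
  assumes "0 \<le> x"
  shows "weight j x = weight_tail j x - weight_tail (Suc j) x"
proof -
  define d where "d = \<theta> * real (m + j) + x"
  have d: "d > 0" using denominator_pos[OF assms] by (simp add: d_def)
  have s: "\<theta> * real (m + Suc j) + x = d + \<theta>" by (simp add: d_def algebra_simps)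
  have "weight_tail j x - weight_tail (Suc j) x = (1 + \<theta> * x) / \<theta> * (1 / d - 1 / (d + \<theta>))"
    unfolding weight_tail_alt[OF assms] s by (simp add: d_def right_diff_distrib)
  also have "1 / d - 1 / (d + \<theta>) = \<theta> / (d * (d + \<theta>))"
    using d theta_pos by (simp add: field_simps)
  finally show ?thesis unfolding weight_def s using theta_pos by (simp add: d_def)
qed

lemma weight_tail_0: "0 \<le> x \<Longrightarrow> weight_tail 0 x = 1"
proof -
  assume "0 \<le> x"
  then have "1 + \<theta> * x > 0" using theta_pos by (intro add_pos_nonneg) auto
  then show ?thesis by (simp add: weight_tail_def)
qed

lemma weight_tail_nonneg: "0 \<le> x \<Longrightarrow> 0 \<le> weight_tail k x"
  using theta_pos by (simp add: weight_tail_def)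

text \<open>The complement to 1 is a nonnegative constant over an increasing denominator. This gives
  both the stochastic order of the digit laws and the monotonicity needed to feed a tail into
  \<open>decorrelation\<close>.\<close>

lemma weight_tail_mono:
  assumes "0 \<le> x" "x \<le> y" shows "weight_tail k x \<le> weight_tail k y"
proof -
  have *: "weight_tail k z = 1 - real k * \<theta>\<^sup>2 / (1 + real k * \<theta>\<^sup>2 + \<theta> * z)" if "0 \<le> z" for z
  proof -
    have "1 + real k * \<theta>\<^sup>2 + \<theta> * z > 0" using theta_pos that by (intro add_pos_nonneg) auto
    then show ?thesis by (simp add: weight_tail_def field_simps)
  qed
  have p: "1 + real k * \<theta>\<^sup>2 + \<theta> * x > 0" using theta_pos assms by (intro add_pos_nonneg) auto
  have "\<theta> * x \<le> \<theta> * y" using assms theta_pos by simp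
  then have "real k * \<theta>\<^sup>2 / (1 + real k * \<theta>\<^sup>2 + \<theta> * y) \<le> real k * \<theta>\<^sup>2 / (1 + real k * \<theta>\<^sup>2 + \<theta> * x)"
    using p by (intro divide_left_mono) auto
  then show ?thesis using assms by (simp add: *)
qed

lemma weight_tail_tendsto: "(\<lambda>k. weight_tail k x) \<longlonglongrightarrow> 0"
proof -
  have "filterlim (\<lambda>k. (1 + \<theta> * x) + real k * \<theta>\<^sup>2) at_top sequentially"
    using theta_pos
    by (intro filterlim_tendsto_add_at_top[OF tendsto_const]
        filterlim_at_top_mult_tendsto_pos[OF tendsto_const] filterlim_real_sequentially) auto
  then have "filterlim (\<lambda>k. 1 + real k * \<theta>\<^sup>2 + \<theta> * x) at_top sequentially"
    by (simp add: add_ac)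
  then show ?thesis unfolding weight_tail_def
    by (intro real_tendsto_divide_at_top[OF tendsto_const])
qed

lemma weight_sums:
  assumes "0 \<le> x" shows "(\<lambda>j. weight (k + j) x) sums weight_tail k x"
proof -
  have "(\<lambda>j. weight_tail (k + j) x) \<longlonglongrightarrow> 0"
    using LIMSEQ_ignore_initial_segment[OF weight_tail_tendsto[of x], of k] by (simp add: add.commute)
  from telescope_sums'[OF this] show ?thesis using assms by (simp add: weight_eq_diff)
qed

lemma summable_weight: "0 \<le> x \<Longrightarrow> summable (\<lambda>j. weight j x)"
  using weight_sums[of x 0] by (auto simp: sums_iff)

lemma suminf_weight: "0 \<le> x \<Longrightarrow> (\<Sum>j. weight j x) = 1"
  using weight_sums[of x 0] weight_tail_0[of x] by (auto simp: sums_iff)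

lemma summable_weight_mult:
  assumes "0 \<le> x" "\<And>j. 0 \<le> a j" "\<And>j. a j \<le> B"
  shows "summable (\<lambda>j. weight j x * a j)"
proof (rule summable_comparison_test')
  show "summable (\<lambda>j. weight j x * B)" by (intro summable_mult2 summable_weight assms)
  show "norm (weight j x * a j) \<le> weight j x * B" for j
    using assms weight_nonneg[OF assms(1), of j] by (simp add: abs_mult mult_left_mono)
qed

lemma summable_gauss_op:
  assumes "\<And>y. y \<in> {0..\<theta>} \<Longrightarrow> 0 \<le> g y \<and> g y \<le> B" "0 \<le> x"
  shows "summable (\<lambda>j. weight j x * g (branch j x))"
  using assms branch_pos[OF assms(2)] branch_le[OF assms(2)]
  by (intro summable_weight_mult[where B = B]) (auto simp: less_imp_le)

lemma gauss_op_bounds: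
  assumes g: "\<And>y. y \<in> {0..\<theta>} \<Longrightarrow> 0 \<le> g y \<and> g y \<le> B" and x: "0 \<le> x"
  shows "0 \<le> gauss_op g x" "gauss_op g x \<le> B"
proof -
  have *: "0 \<le> g (branch j x) \<and> g (branch j x) \<le> B" for j
    using g branch_pos[OF x, of j] branch_le[OF x, of j] by auto
  show "0 \<le> gauss_op g x"
    unfolding gauss_op_def using * weight_nonneg[OF x]
    by (intro suminf_nonneg summable_gauss_op[OF g x]) auto
  have "gauss_op g x \<le> (\<Sum>j. weight j x * B)"
    unfolding gauss_op_def using * weight_nonneg[OF x]
    by (intro suminf_le summable_gauss_op[OF g x] summable_mult2 summable_weight x mult_left_mono) auto
  also have "\<dots> = B" using suminf_mult2[OF summable_weight[OF x], of B] suminf_weight[OF x] by simp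
  finally show "gauss_op g x \<le> B" .
qed

text \<open>The law of the first digit of a preimage of \<open>x\<close> is stochastically increasing in \<open>x\<close>.\<close>

lemma suminf_weight_antimono:
  assumes x: "0 \<le> x" "x \<le> y" and a: "\<And>j. 0 \<le> a j" "\<And>j. a j \<le> B" "\<And>j. a (Suc j) \<le> a j"
  shows "(\<Sum>j. weight j y * a j) \<le> (\<Sum>j. weight j x * a j)"
proof -
  have y: "0 \<le> y" using x by simp
  define D where "D j = weight_tail j y - weight_tail j x" for j
  have D: "0 \<le> D j" for j using weight_tail_mono[OF x] by (simp add: D_def)
  have D0: "D 0 = 0" using x y by (simp add: D_def weight_tail_0)
  \<comment> \<open>Summation by parts: D is nonnegative and a decreases, so only a boundary term of
    favourable sign remains.\<close>
  have fin: "(\<Sum>j<N. (D j - D (Suc j)) * a j) \<le> - D N * a N" for N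
  proof (induction N)
    case (Suc N)
    have "D (Suc N) * a (Suc N) \<le> D (Suc N) * a N" using D a by (intro mult_left_mono) auto
    with Suc show ?case by (simp add: algebra_simps)
  qed (simp add: D0)
  have "(\<Sum>j<N. weight j y * a j) \<le> (\<Sum>j<N. weight j x * a j)" for N
  proof -
    have "(\<Sum>j<N. weight j y * a j) - (\<Sum>j<N. weight j x * a j) = (\<Sum>j<N. (D j - D (Suc j)) * a j)"
      using x y by (simp add: sum_subtractf[symmetric] weight_eq_diff D_def algebra_simps)
    also have "\<dots> \<le> 0" using fin[of N] mult_nonneg_nonneg[OF D a(1), of N N] by linarith
    finally show ?thesis by simp
  qed
  moreover have "summable (\<lambda>j. weight j x * a j)" "summable (\<lambda>j. weight j y * a j)"
    using a x y by (auto intro!: summable_weight_mult[where B = B])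
  ultimately show ?thesis
    by (intro LIMSEQ_le[OF summable_LIMSEQ summable_LIMSEQ]) auto
qed

text \<open>Two effects act in the same direction when x grows: every branch moves down, and mass
  shifts to larger indices, whose branches lie lower. The intermediate sum changes the points first
  and the weights afterwards.\<close>

lemma gauss_op_antimono:
  assumes g: "\<And>y. y \<in> {0..\<theta>} \<Longrightarrow> 0 \<le> g y \<and> g y \<le> B" and mono: "mono_on {0..\<theta>} g"
    and x: "0 \<le> x" "x \<le> y"
  shows "gauss_op g y \<le> gauss_op g x"
proof -
  have y: "0 \<le> y" using x by simp
  have r: "branch j z \<in> {0..\<theta>}" if "0 \<le> z" for j z
    using branch_pos[OF that, of j] branch_le[OF that, of j] by auto
  have "gauss_op g y \<le> (\<Sum>j. weight j y * g (branch j x))"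
    unfolding gauss_op_def
  proof (rule suminf_le)
    show "weight j y * g (branch j y) \<le> weight j y * g (branch j x)" for j
      using weight_nonneg[OF y] r x branch_antimono[OF x, of j] y
      by (intro mult_left_mono mono_onD[OF mono]) auto
    show "summable (\<lambda>j. weight j y * g (branch j x))"
      using g r x by (intro summable_weight_mult[OF y, of _ B]) auto
  qed (rule summable_gauss_op[OF g y])
  also have "\<dots> \<le> gauss_op g x"
    unfolding gauss_op_def
  proof (rule suminf_weight_antimono[OF x, of _ B])
    show "g (branch (Suc j) x) \<le> g (branch j x)" for j
    proof (rule mono_onD[OF mono])
      show "branch (Suc j) x \<le> branch j x"
        unfolding branch_def using x denominator_pos[of x j] denominator_pos[of x "Suc j"] theta_pos
        by (intro divide_left_mono mult_pos_pos) auto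
    qed (use r x in auto)
  qed (use g r x in auto)
  finally show ?thesis .
qed

definition contraction :: real where "contraction = 1 / (real m + 1)"

lemma contraction_bounds: "0 < contraction" "contraction \<le> 1 / 2"
  using m_pos by (auto simp: contraction_def field_simps)

text \<open>Both endpoint sums run over the same points, as \<open>branch j \<theta> = branch (Suc j) 0\<close>, except
  for the extra point \<open>branch 0 0 = \<theta>\<close>, whose weight is the contraction factor.\<close>

lemma gauss_op_contraction:
  assumes g: "\<And>y. y \<in> {0..\<theta>} \<Longrightarrow> 0 \<le> g y \<and> g y \<le> B"
  shows "gauss_op g 0 - gauss_op g \<theta> \<le> contraction * B"
proof -
  define b where "b j = g (branch j \<theta>)" for j
  have th: "0 \<le> \<theta>" using theta_pos by simp
  have b: "0 \<le> b j" for j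
    using g[of "branch j \<theta>"] branch_pos[OF th, of j] branch_le[OF th, of j] by (auto simp: b_def)
  have s0: "summable (\<lambda>j. weight j 0 * g (branch j 0))" by (rule summable_gauss_op[OF g]) auto
  have s1: "summable (\<lambda>j. weight j \<theta> * b j)"
    unfolding b_def by (rule summable_gauss_op[OF g th])
  have "summable (\<lambda>j. weight (Suc j) 0 * g (branch (Suc j) 0))"
    using s0 by (subst summable_Suc_iff)
  then have s2: "summable (\<lambda>j. weight (Suc j) 0 * b j)"
    by (simp add: branch_Suc b_def)
  have "gauss_op g 0 = weight 0 0 * g (branch 0 0) + (\<Sum>j. weight (Suc j) 0 * b j)"
    using suminf_split_head[OF s0] by (simp add: gauss_op_def branch_Suc b_def)
  \<comment> \<open>At the shared points the weights seen from \<theta> exceed those seen from 0 by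
    the factor 1 + \<theta>^2, so g enters only through its sign.\<close>
  moreover have "(\<Sum>j. weight (Suc j) 0 * b j) \<le> (\<Sum>j. weight j \<theta> * b j)"
  proof (intro suminf_le s1 s2 mult_right_mono b)
    fix j
    define d where "d = \<theta> * real (m + Suc j)"
    have d: "d > 0" using denominator_pos[of 0 "Suc j"] by (simp add: d_def)
    have "weight (Suc j) 0 = 1 / (d * (d + \<theta>))" "weight j \<theta> = (1 + \<theta> * \<theta>) / (d * (d + \<theta>))"
      by (simp_all add: weight_def d_def algebra_simps)
    then show "weight (Suc j) 0 \<le> weight j \<theta>"
      using d theta_pos by (simp add: divide_right_mono)
  qed
  moreover have "weight 0 0 = contraction"
    using m_pos theta_pos theta_sq
    by (simp add: weight_def contraction_def algebra_simps m_theta power2_eq_square)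
  moreover have "contraction * g (branch 0 0) \<le> contraction * B"
    using g[of "branch 0 0"] branch_pos[of 0 0] branch_le[of 0 0] contraction_bounds
    by (intro mult_left_mono) auto
  moreover have "gauss_op g \<theta> = (\<Sum>j. weight j \<theta> * b j)"
    by (simp add: gauss_op_def b_def)
  ultimately show ?thesis by simp
qed

subsection \<open>Decay of correlations\<close>

interpretation P: prob_space M by (rule prob_space_M)

lemma prob_UNIV [simp]: "measure M UNIV = 1"
  using P.prob_space by simp

lemma measurable_M_iff [simp]: "measurable M N = measurable borel N"
  by (rule measurable_cong_sets) simp_all

lemma integrable_M:
  fixes f :: "real \<Rightarrow> real"
  assumes "f \<in> borel_measurable borel" "\<And>x. x \<in> {0..\<theta>} \<Longrightarrow> \<bar>f x\<bar> \<le> B"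
  shows "integrable M f"
  using AE_M_range assms by (intro P.integrable_const_bound[where B = B]) auto

lemma integral_M_mono:
  fixes f g :: "real \<Rightarrow> real"
  assumes "integrable M f" "integrable M g" "\<And>x. x \<in> {0<..<\<theta>} \<Longrightarrow> f x \<le> g x"
  shows "integral\<^sup>L M f \<le> integral\<^sup>L M g"
  using AE_M_range_open assms by (intro integral_mono_AE) auto

text \<open>Duality with g = 1: the weights sum to 1, so constants are fixed by the transfer
  operator.\<close>

lemma distr_T: "distr M borel T = M"
proof (rule measure_eqI)
  fix A assume "A \<in> sets (distr M borel T)"
  then have [measurable]: "A \<in> sets borel" by simp
  have "emeasure (distr M borel T) A = (\<integral>\<^sup>+x. indicator A x \<partial>distr M borel T)" by simp
  also have "\<dots> = (\<integral>\<^sup>+x. 1 * indicator A (T x) \<partial>M)"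
    by (subst nn_integral_distr) auto
  also have "\<dots> = (\<integral>\<^sup>+x. (\<Sum>j. ennreal (weight j x) * 1) * indicator A x \<partial>M)"
    by (rule nn_integral_transfer) measurable
  also have "\<dots> = (\<integral>\<^sup>+x. indicator A x \<partial>M)"
  proof (rule nn_integral_cong_AE)
    show "AE x in M. (\<Sum>j. ennreal (weight j x) * 1) * indicator A x = indicator A x"
      using AE_M_range
      by (rule AE_mp) (auto simp: suminf_ennreal2 weight_nonneg summable_weight suminf_weight)
  qed
  finally show "emeasure (distr M borel T) A = emeasure M A" by simp
qed simp

lemma distr_T_pow: "distr M borel (T ^^ k) = M"
proof (induction k)
  case 0
  show ?case by (simp add: distr_id2)
next
  case (Suc k)
  have "distr (distr M borel (T ^^ k)) borel T = distr M borel (T ^^ Suc k)"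
    by (subst distr_distr) auto
  then show ?case using Suc distr_T by (simp del: funpow.simps)
qed

lemma integral_T_pow:
  fixes f :: "real \<Rightarrow> real"
  assumes "f \<in> borel_measurable borel"
  shows "(\<integral>x. f ((T ^^ k) x) \<partial>M) = integral\<^sup>L M f"
  using integral_distr[of "T ^^ k" M borel f] assms by (simp add: distr_T_pow)

lemma T_pow_range: "x \<in> {0..\<theta>} \<Longrightarrow> (T ^^ k) x \<in> {0..\<theta>}"
proof (induction k)
  case (Suc k)
  then show ?case using T_range[of "(T ^^ k) x"] by auto
qed simp

lemma T_pow_add: "(T ^^ j) ((T ^^ k) x) = (T ^^ (j + k)) x"
  by (simp add: funpow_add)

lemma integral_transfer:
  assumes [measurable]: "g \<in> borel_measurable borel" "\<phi> \<in> borel_measurable borel"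
    and g: "\<And>y. y \<in> {0..\<theta>} \<Longrightarrow> 0 \<le> g y \<and> g y \<le> B"
    and \<phi>: "\<And>y. y \<in> {0..\<theta>} \<Longrightarrow> 0 \<le> \<phi> y"
  shows "(\<integral>x. g x * \<phi> (T x) \<partial>M) = (\<integral>x. gauss_op g x * \<phi> x \<partial>M)"
proof -
  have T: "T x \<in> {0..\<theta>}" if "x \<in> {0..\<theta>}" for x using T_range[of x] that by auto
  have "(\<integral>x. g x * \<phi> (T x) \<partial>M) = enn2real (\<integral>\<^sup>+x. ennreal (g x * \<phi> (T x)) \<partial>M)"
    by (rule integral_eq_nn_integral) (use AE_M_range g \<phi> T in auto)
  also have "(\<integral>\<^sup>+x. ennreal (g x * \<phi> (T x)) \<partial>M) = (\<integral>\<^sup>+x. ennreal (g x) * ennreal (\<phi> (T x)) \<partial>M)"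
    by (rule nn_integral_cong_AE, rule AE_mp[OF AE_M_range], rule AE_I2)
      (use g \<phi> T in \<open>auto simp: ennreal_mult\<close>)
  also have "\<dots> = (\<integral>\<^sup>+x. (\<Sum>j. ennreal (weight j x) * ennreal (g (branch j x))) * ennreal (\<phi> x) \<partial>M)"
    by (rule nn_integral_transfer) measurable
  also have "\<dots> = (\<integral>\<^sup>+x. ennreal (gauss_op g x * \<phi> x) \<partial>M)"
  proof (rule nn_integral_cong_AE, rule AE_mp[OF AE_M_range], intro AE_I2 impI)
    fix x assume x: "x \<in> {0..\<theta>}"
    then have x0: "0 \<le> x" by simp
    have b: "0 \<le> g (branch j x)" for j
      using g[of "branch j x"] branch_pos[OF x0, of j] branch_le[OF x0, of j] by auto
    have "(\<Sum>j. ennreal (weight j x) * ennreal (g (branch j x))) = (\<Sum>j. ennreal (weight j x * g (branch j x)))"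
      using b weight_nonneg[OF x0] by (simp add: ennreal_mult)
    also have "\<dots> = ennreal (gauss_op g x)"
      unfolding gauss_op_def using b weight_nonneg[OF x0] summable_gauss_op[OF g x0]
      by (intro suminf_ennreal2) auto
    finally show "(\<Sum>j. ennreal (weight j x) * ennreal (g (branch j x))) * ennreal (\<phi> x) =
      ennreal (gauss_op g x * \<phi> x)"
      using \<phi>[OF x] gauss_op_bounds(1)[OF g x0] by (simp add: ennreal_mult)
  qed
  also have "enn2real \<dots> = (\<integral>x. gauss_op g x * \<phi> x \<partial>M)"
    by (rule integral_eq_nn_integral[symmetric])
      (use AE_M_range gauss_op_bounds(1)[OF g] \<phi> in auto)
  finally show ?thesis .
qed

lemma integral_gauss_op:
  assumes "g \<in> borel_measurable borel" "\<And>y. y \<in> {0..\<theta>} \<Longrightarrow> 0 \<le> g y \<and> g y \<le> B"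
  shows "integral\<^sup>L M (gauss_op g) = integral\<^sup>L M g"
  using integral_transfer[of g "\<lambda>_. 1" B] assms by simp

text \<open>The induction reflects \<open>gauss_op g\<close>, which is decreasing, to the increasing function
  \<open>gauss_op g 0 - gauss_op g\<close>, whose range is smaller by the contraction factor.\<close>

lemma decorrelation:
  assumes "g \<in> borel_measurable borel" "\<phi> \<in> borel_measurable borel"
    and "mono_on {0..\<theta>} g" "\<And>y. y \<in> {0..\<theta>} \<Longrightarrow> 0 \<le> g y \<and> g y \<le> B"
    and "\<And>y. y \<in> {0..\<theta>} \<Longrightarrow> 0 \<le> \<phi> y \<and> \<phi> y \<le> C"
  shows "\<bar>(\<integral>x. g x * \<phi> ((T ^^ d) x) \<partial>M) - integral\<^sup>L M g * integral\<^sup>L M \<phi>\<bar>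
    \<le> B * contraction ^ d * integral\<^sup>L M \<phi>"
  using assms
proof (induction d arbitrary: g B)
  case 0
  note [measurable] = 0(1,2) and g = 0(4) and \<phi> = 0(5)
  have B: "0 \<le> B" using g[of 0] theta_pos by auto
  have int: "integrable M g" "integrable M \<phi>" "integrable M (\<lambda>x. g x * \<phi> x)"
  proof -
    show "integrable M g" by (rule integrable_M[of _ B]) (use g in auto)
    show "integrable M \<phi>" by (rule integrable_M[of _ C]) (use \<phi> in auto)
    show "integrable M (\<lambda>x. g x * \<phi> x)"
      by (rule integrable_M[of _ "B * C"]) (use g \<phi> B in \<open>auto simp: abs_mult intro!: mult_mono\<close>)
  qed
  have p: "0 \<le> integral\<^sup>L M \<phi>" "0 \<le> integral\<^sup>L M g"
    by (rule integral_nonneg_AE; use AE_M_range g \<phi> in auto)+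
  have "integral\<^sup>L M g \<le> (\<integral>x. B \<partial>M)"
    by (rule integral_M_mono) (use int g in auto)
  then have gB: "integral\<^sup>L M g \<le> B" by simp
  \<comment> \<open>The integral of the product and the product of the integrals both lie between 0
    and \<open>B * integral\<^sup>L M \<phi>\<close>, hence differ by at most that.\<close>
  have 1: "0 \<le> integral\<^sup>L M g * integral\<^sup>L M \<phi>" "integral\<^sup>L M g * integral\<^sup>L M \<phi> \<le> B * integral\<^sup>L M \<phi>"
    using p gB by (auto intro: mult_right_mono)
  have "(\<integral>x. g x * \<phi> x \<partial>M) \<le> (\<integral>x. B * \<phi> x \<partial>M)"
    by (rule integral_M_mono) (use int g \<phi> in \<open>auto intro: mult_right_mono\<close>)
  moreover have "0 \<le> (\<integral>x. g x * \<phi> x \<partial>M)"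
    by (rule integral_nonneg_AE) (use AE_M_range g \<phi> in auto)
  ultimately show ?case using 1 by simp
next
  case (Suc d)
  note [measurable] = Suc.prems(1,2) and g = Suc.prems(4) and \<phi> = Suc.prems(5)
  have th: "0 \<le> \<theta>" using theta_pos by simp
  define \<psi> where "\<psi> x = \<phi> ((T ^^ d) x)" for x
  have [measurable]: "\<psi> \<in> borel_measurable borel" unfolding \<psi>_def by measurable
  have \<psi>: "0 \<le> \<psi> y \<and> \<psi> y \<le> C" if "y \<in> {0..\<theta>}" for y
    using \<phi> T_pow_range[OF that] by (simp add: \<psi>_def)
  have B: "0 \<le> B" using g[of 0] theta_pos by auto
  define h where "h x = gauss_op g 0 - gauss_op g x" for x
  have [measurable]: "h \<in> borel_measurable borel" unfolding h_def by measurable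
  have h_mono: "mono_on {0..\<theta>} h"
    by (intro mono_onI) (auto simp: h_def intro!: gauss_op_antimono[OF g Suc.prems(3)])
  have c: "gauss_op g 0 - gauss_op g \<theta> \<le> contraction * B"
    by (rule gauss_op_contraction[OF g])
  have h: "0 \<le> h y \<and> h y \<le> contraction * B" if "y \<in> {0..\<theta>}" for y
    using gauss_op_antimono[OF g Suc.prems(3), of 0 y] gauss_op_antimono[OF g Suc.prems(3), of y \<theta>]
      c that by (auto simp: h_def)
  have qB: "0 \<le> contraction * B" using B contraction_bounds by simp
  have int: "integrable M h" "integrable M \<psi>" "integrable M (\<lambda>x. h x * \<psi> x)" "integrable M (gauss_op g)"
  proof -
    show "integrable M h" by (rule integrable_M[of _ "contraction * B"]) (use h in auto)
    show "integrable M \<psi>" by (rule integrable_M[of _ C]) (use \<psi> in auto)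
    show "integrable M (\<lambda>x. h x * \<psi> x)"
      by (rule integrable_M[of _ "contraction * B * C"])
        (use h \<psi> qB in \<open>auto simp: abs_mult intro!: mult_mono\<close>)
    show "integrable M (gauss_op g)"
      by (rule integrable_M[of _ B]) (use gauss_op_bounds[OF g] in auto)
  qed
  have Eg: "integral\<^sup>L M g = gauss_op g 0 - integral\<^sup>L M h"
  proof -
    have "integral\<^sup>L M h = (\<integral>x. gauss_op g 0 - gauss_op g x \<partial>M)"
      by (rule Bochner_Integration.integral_cong) (auto simp: h_def)
    also have "\<dots> = gauss_op g 0 - integral\<^sup>L M (gauss_op g)"
      using int(4) by simp
    finally show ?thesis using integral_gauss_op[OF Suc.prems(1) g] by simp
  qed
  have E\<psi>: "integral\<^sup>L M \<psi> = integral\<^sup>L M \<phi>"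
    unfolding \<psi>_def by (rule integral_T_pow) measurable
  have "(\<integral>x. g x * \<phi> ((T ^^ Suc d) x) \<partial>M) = (\<integral>x. g x * \<psi> (T x) \<partial>M)"
    by (simp add: \<psi>_def funpow_Suc_right del: funpow.simps)
  also have "\<dots> = (\<integral>x. gauss_op g x * \<psi> x \<partial>M)"
    by (rule integral_transfer[OF _ _ g]) (use \<psi> in auto)
  also have "\<dots> = (\<integral>x. gauss_op g 0 * \<psi> x - h x * \<psi> x \<partial>M)"
    by (simp add: h_def algebra_simps)
  also have "\<dots> = gauss_op g 0 * integral\<^sup>L M \<phi> - (\<integral>x. h x * \<psi> x \<partial>M)"
    using int E\<psi> by simp
  \<comment> \<open>The constant \<open>gauss_op g 0\<close> drops out of the covariance, so the
    reflection only changes its sign.\<close>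
  finally have "(\<integral>x. g x * \<phi> ((T ^^ Suc d) x) \<partial>M) - integral\<^sup>L M g * integral\<^sup>L M \<phi> =
     - ((\<integral>x. h x * \<psi> x \<partial>M) - integral\<^sup>L M h * integral\<^sup>L M \<phi>)"
    by (simp add: Eg algebra_simps)
  then show ?case
    using Suc.IH[of h "contraction * B"] Suc.prems(2,5) h_mono h by (simp add: \<psi>_def mult_ac)
qed

section \<open>Digit tails and their covariances\<close>

definition exceeds :: "nat \<Rightarrow> real \<Rightarrow> real" where
  "exceeds s x = of_bool (int s \<le> first_digit x)"

lemma measurable_exceeds [measurable]: "exceeds s \<in> borel_measurable borel"
  unfolding exceeds_def[abs_def] by measurable

lemma exceeds_bounds: "0 \<le> exceeds s x" "exceeds s x \<le> 1"
  by (auto simp: exceeds_def)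

text \<open>On branch j the indicator is 1 exactly for \<open>j \<ge> s - m\<close>. Truncated
  subtraction gives the right value for \<open>s \<le> m\<close> too: all digits are at least m, and
  the tail from 0 is 1.\<close>

lemma gauss_op_exceeds:
  assumes "0 \<le> x" "x < \<theta>"
  shows "gauss_op (exceeds s) x = weight_tail (s - m) x"
proof -
  have *: "exceeds s (branch j x) = of_bool (s - m \<le> j)" for j
    by (auto simp: exceeds_def first_digit_branch[OF assms])
  have "(\<lambda>j. weight (j + (s - m)) x * exceeds s (branch (j + (s - m)) x)) sums weight_tail (s - m) x"
    using weight_sums[OF assms(1), of "s - m"] unfolding * by (simp add: add.commute)
  then have "(\<lambda>j. weight j x * exceeds s (branch j x)) sums weight_tail (s - m) x"
    by (subst (asm) sums_zero_iff_shift) (auto simp: *)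
  then show ?thesis unfolding gauss_op_def by (rule sums_unique[symmetric])
qed

text \<open>The numerator is at most 2 and the denominator at least s / m. Uniformity in x is the
  point: even conditionally on the future, a digit reaches s with probability O(1 / s).\<close>

lemma weight_tail_le:
  assumes "0 \<le> x" "x \<le> \<theta>" "0 < s"
  shows "weight_tail (s - m) x \<le> 2 * real m / real s"
proof -
  have "\<theta> * x \<le> \<theta> * \<theta>" using assms theta_pos by simp
  also have "\<dots> = 1 / real m" using theta_sq by (simp add: power2_eq_square)
  also have "\<dots> \<le> 1" using m_pos by simp
  finally have 1: "1 + \<theta> * x \<le> 2" by simp
  have "real s / real m \<le> 1 + real (s - m) / real m"
    using m_pos by (simp add: field_simps of_nat_diff_real)
  also have "\<dots> \<le> 1 + real (s - m) * \<theta>\<^sup>2 + \<theta> * x"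
    using assms theta_pos theta_sq by simp
  finally have "weight_tail (s - m) x \<le> 2 / (real s / real m)"
    unfolding weight_tail_def using 1 assms m_pos theta_pos by (intro frac_le) auto
  then show ?thesis by (simp add: mult.commute)
qed

lemma integrable_exceeds: "integrable M (exceeds s)"
  by (rule integrable_M[of _ 1]) (use exceeds_bounds in auto)

lemma measurable_weight_tail [measurable]: "weight_tail k \<in> borel_measurable borel"
  unfolding weight_tail_def[abs_def] by measurable

lemma integral_exceeds: "integral\<^sup>L M (exceeds s) = integral\<^sup>L M (weight_tail (s - m))"
proof -
  have "integral\<^sup>L M (exceeds s) = integral\<^sup>L M (gauss_op (exceeds s))"
    using integral_gauss_op[of "exceeds s" 1] exceeds_bounds by simp
  also have "\<dots> = integral\<^sup>L M (weight_tail (s - m))"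
    by (rule integral_cong_AE) (use AE_M_range_open gauss_op_exceeds in auto)
  finally show ?thesis .
qed

lemma integral_exceeds_le:
  assumes s: "0 < s"
  shows "integral\<^sup>L M (exceeds s) \<le> 2 * real m / real s"
proof -
  have "integral\<^sup>L M (weight_tail (s - m)) \<le> (\<integral>x. 2 * real m / real s \<partial>M)"
  proof (rule integral_M_mono)
    show "integrable M (weight_tail (s - m))"
      by (rule integrable_M[of _ "2 * real m / real s"])
        (use weight_tail_le[OF _ _ s] weight_tail_nonneg in auto)
  qed (use weight_tail_le[OF _ _ s] in auto)
  then show ?thesis
    by (simp add: integral_exceeds)
qed

text \<open>One iterate is spent to replace an indicator by a function that is increasing and of
  size O(1 / s).\<close>

lemma integral_exceeds_transfer:
  "(\<integral>x. exceeds s x * exceeds t ((T ^^ Suc d) x) \<partial>M) =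
    (\<integral>x. weight_tail (s - m) x * exceeds t ((T ^^ d) x) \<partial>M)"
proof -
  have "(\<integral>x. exceeds s x * exceeds t ((T ^^ Suc d) x) \<partial>M) =
      (\<integral>x. exceeds s x * exceeds t ((T ^^ d) (T x)) \<partial>M)"
    by (simp add: funpow_Suc_right del: funpow.simps)
  also have "\<dots> = (\<integral>x. gauss_op (exceeds s) x * exceeds t ((T ^^ d) x) \<partial>M)"
    by (rule integral_transfer[where B = 1]) (use exceeds_bounds in auto)
  also have "\<dots> = (\<integral>x. weight_tail (s - m) x * exceeds t ((T ^^ d) x) \<partial>M)"
    by (rule integral_cong_AE) (use AE_M_range_open gauss_op_exceeds in auto)
  finally show ?thesis .
qed

lemma integral_exceeds_pair:
  assumes "0 < s" "0 < t"
  shows "(\<integral>x. exceeds s x * exceeds t ((T ^^ Suc d) x) \<partial>M) \<le> 4 * (real m)\<^sup>2 / (real s * real t)"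
proof -
  let ?b = "2 * real m / real s"
  have "(\<integral>x. weight_tail (s - m) x * exceeds t ((T ^^ d) x) \<partial>M) \<le> (\<integral>x. ?b * exceeds t ((T ^^ d) x) \<partial>M)"
  proof (rule integral_M_mono)
    show "integrable M (\<lambda>x. weight_tail (s - m) x * exceeds t ((T ^^ d) x))"
    proof (rule integrable_M)
      fix x assume x: "x \<in> {0..\<theta>}"
      have "\<bar>weight_tail (s - m) x\<bar> \<le> ?b" "\<bar>exceeds t ((T ^^ d) x)\<bar> \<le> 1"
        using weight_tail_le[of x s] weight_tail_nonneg[of x] x assms exceeds_bounds by auto
      then show "\<bar>weight_tail (s - m) x * exceeds t ((T ^^ d) x)\<bar> \<le> ?b * 1"
        unfolding abs_mult by (intro mult_mono) auto
    qed measurable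
    show "integrable M (\<lambda>x. ?b * exceeds t ((T ^^ d) x))"
      by (rule integrable_M[of _ "?b * 1"])
        (use exceeds_bounds in \<open>auto simp: abs_mult intro!: mult_left_le divide_right_mono\<close>)
    fix x assume "x \<in> {0<..<\<theta>}"
    then show "weight_tail (s - m) x * exceeds t ((T ^^ d) x) \<le> ?b * exceeds t ((T ^^ d) x)"
      using assms exceeds_bounds by (intro mult_right_mono weight_tail_le) auto
  qed
  also have "\<dots> = ?b * integral\<^sup>L M (exceeds t)"
    using integral_T_pow[of "exceeds t" d] by simp
  also have "\<dots> \<le> ?b * (2 * real m / real t)"
    by (intro mult_left_mono integral_exceeds_le assms) auto
  finally show ?thesis unfolding integral_exceeds_transfer by (simp add: power2_eq_square)
qed

text \<open>The indicator itself is in general not increasing and has supremum 1; its image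
  \<open>weight_tail\<close> is increasing with supremum O(1 / s). The factor 1 / s thus comes from
  the bound B of \<open>decorrelation\<close>, and 1 / t from the mean of the second
  indicator.\<close>

lemma covariance_exceeds:
  assumes "0 < s" "0 < t"
  shows "\<bar>(\<integral>x. exceeds s x * exceeds t ((T ^^ Suc d) x) \<partial>M) -
      integral\<^sup>L M (exceeds s) * integral\<^sup>L M (exceeds t)\<bar>
    \<le> 4 * (real m)\<^sup>2 * contraction ^ d * (1 / real s) * (1 / real t)"
proof -
  let ?b = "2 * real m / real s"
  have "\<bar>(\<integral>x. weight_tail (s - m) x * exceeds t ((T ^^ d) x) \<partial>M) -
      integral\<^sup>L M (weight_tail (s - m)) * integral\<^sup>L M (exceeds t)\<bar> \<le> ?b * contraction ^ d * integral\<^sup>L M (exceeds t)"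
    by (rule decorrelation[where C = 1])
      (use weight_tail_le[OF _ _ assms(1)] weight_tail_nonneg weight_tail_mono exceeds_bounds
        in \<open>auto intro!: mono_onI\<close>)
  also have "\<dots> \<le> ?b * contraction ^ d * (2 * real m / real t)"
    using contraction_bounds by (intro mult_left_mono integral_exceeds_le assms) auto
  also have "\<dots> = 4 * (real m)\<^sup>2 * contraction ^ d * (1 / real s) * (1 / real t)"
    by (simp add: power2_eq_square)
  finally show ?thesis by (simp only: integral_exceeds_transfer integral_exceeds[of s])
qed

subsection \<open>Truncated sums\<close>

text \<open>Layer-cake form of the minimum of the first digit and \<tau>; it reduces moments and
  covariances of truncated digits to those of tail indicators.\<close>

definition trunc :: "nat \<Rightarrow> real \<Rightarrow> real" where
  "trunc \<tau> x = (\<Sum>s=1..\<tau>. exceeds s x)"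

lemma measurable_trunc [measurable]: "trunc \<tau> \<in> borel_measurable borel"
  unfolding trunc_def[abs_def] by measurable

lemma trunc_bounds: "0 \<le> trunc \<tau> x" "trunc \<tau> x \<le> real \<tau>"
proof -
  show "0 \<le> trunc \<tau> x" unfolding trunc_def by (intro sum_nonneg exceeds_bounds)
  show "trunc \<tau> x \<le> real \<tau>"
    unfolding trunc_def using sum_mono[of "{1..\<tau>}" "\<lambda>s. exceeds s x" "\<lambda>_. 1"] exceeds_bounds by simp
qed

lemma first_digit_nonneg: "0 \<le> x \<Longrightarrow> 0 \<le> first_digit x"
  using theta_pos by (simp add: first_digit_def)

lemma trunc_eq_min:
  assumes "0 \<le> x" shows "trunc \<tau> x = min (real_of_int (first_digit x)) (real \<tau>)"
proof -
  obtain n where n: "first_digit x = int n" using first_digit_nonneg[OF assms] nonneg_int_cases by blast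
  have "trunc \<tau> x = (\<Sum>s\<in>{1..\<tau>}. if s \<in> {..n} then 1 else 0)"
    unfolding trunc_def by (rule sum.cong) (auto simp: exceeds_def n)
  also have "\<dots> = (\<Sum>s\<in>{1..\<tau>} \<inter> {..n}. 1)"
    by (rule sum.inter_restrict[symmetric]) simp
  also have "{1..\<tau>} \<inter> {..n} = {1..min n \<tau>}" by auto
  finally show ?thesis by (simp add: n)
qed

lemma integral_trunc: "integral\<^sup>L M (trunc \<tau>) = (\<Sum>s=1..\<tau>. integral\<^sup>L M (exceeds s))"
  unfolding trunc_def[abs_def] by (rule Bochner_Integration.integral_sum, rule integrable_exceeds)

text \<open>Raising the level from \<tau> to \<tau> + 1 raises the square by at most 2 \<tau> + 1,
  and only where the indicator is 1. A tail of order 1 / s makes each term 2 s P(digit \<ge> s)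
  bounded, so the sum is linear in \<tau>.\<close>

lemma integral_trunc_square: "(\<integral>x. (trunc \<tau> x)\<^sup>2 \<partial>M) \<le> 4 * real m * real \<tau>"
proof -
  have "(trunc \<tau> x)\<^sup>2 \<le> (\<Sum>s=1..\<tau>. 2 * real s * exceeds s x)" for x
  proof (induction \<tau>)
    case (Suc \<tau>)
    have "trunc (Suc \<tau>) x = trunc \<tau> x + exceeds (Suc \<tau>) x" by (simp add: trunc_def)
    then have "(trunc (Suc \<tau>) x)\<^sup>2 = (trunc \<tau> x)\<^sup>2 + (2 * trunc \<tau> x + 1) * exceeds (Suc \<tau>) x"
      by (auto simp: power2_eq_square exceeds_def algebra_simps)
    moreover have "(2 * trunc \<tau> x + 1) * exceeds (Suc \<tau>) x \<le> 2 * real (Suc \<tau>) * exceeds (Suc \<tau>) x"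
      using trunc_bounds[of \<tau> x] exceeds_bounds by (intro mult_right_mono) auto
    ultimately show ?case using Suc by simp
  qed (simp add: trunc_def)
  then have "(\<integral>x. (trunc \<tau> x)\<^sup>2 \<partial>M) \<le> (\<integral>x. (\<Sum>s=1..\<tau>. 2 * real s * exceeds s x) \<partial>M)"
    using trunc_bounds[of \<tau>]
    by (intro integral_M_mono Bochner_Integration.integrable_sum integrable_mult_right integrable_exceeds
        integrable_M[of _ "(real \<tau>)\<^sup>2"]) (auto intro!: power_mono)
  also have "\<dots> = (\<Sum>s=1..\<tau>. 2 * real s * integral\<^sup>L M (exceeds s))"
    by (subst Bochner_Integration.integral_sum) (auto intro: integrable_exceeds)
  also have "\<dots> \<le> (\<Sum>s=1..\<tau>. 4 * real m)"
  proof (rule sum_mono)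
    fix s assume "s \<in> {1..\<tau>}"
    then show "2 * real s * integral\<^sup>L M (exceeds s) \<le> 4 * real m"
      using integral_exceeds_le[of s] by (simp add: field_simps)
  qed
  finally show ?thesis by (simp add: mult.commute)
qed

text \<open>By bilinearity the covariance is a double sum over thresholds, and the bounds 1 / (s t)
  add up to the square of a harmonic sum.\<close>

lemma covariance_trunc:
  "(\<integral>x. trunc \<tau> x * trunc \<tau> ((T ^^ Suc d) x) \<partial>M) - (integral\<^sup>L M (trunc \<tau>))\<^sup>2
    \<le> 12 * (real m)\<^sup>2 * real \<tau> * contraction ^ d"
proof -
  let ?I = "{1..\<tau>}"
  let ?E = "\<lambda>s. integral\<^sup>L M (exceeds s)"
  let ?c = "4 * (real m)\<^sup>2 * contraction ^ d"
  have int: "integrable M (\<lambda>x. exceeds s x * exceeds t ((T ^^ Suc d) x))" for s t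
    by (rule integrable_M[of _ 1]) (use exceeds_bounds in \<open>auto simp: abs_mult intro!: mult_le_one\<close>)
  have "(\<integral>x. trunc \<tau> x * trunc \<tau> ((T ^^ Suc d) x) \<partial>M) =
      (\<Sum>s\<in>?I. \<Sum>t\<in>?I. \<integral>x. exceeds s x * exceeds t ((T ^^ Suc d) x) \<partial>M)"
    unfolding trunc_def sum_product by (simp add: Bochner_Integration.integral_sum int del: funpow.simps)
  then have "(\<integral>x. trunc \<tau> x * trunc \<tau> ((T ^^ Suc d) x) \<partial>M) - (integral\<^sup>L M (trunc \<tau>))\<^sup>2 =
      (\<Sum>s\<in>?I. \<Sum>t\<in>?I. (\<integral>x. exceeds s x * exceeds t ((T ^^ Suc d) x) \<partial>M) - ?E s * ?E t)"
    unfolding integral_trunc power2_eq_square sum_product by (simp add: sum_subtractf del: funpow.simps)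
  also have "\<dots> \<le> (\<Sum>s\<in>?I. \<Sum>t\<in>?I. ?c * (1 / real s) * (1 / real t))"
    by (intro sum_mono order.trans[OF abs_ge_self covariance_exceeds]) auto
  also have "\<dots> = ?c * (\<Sum>s\<in>?I. 1 / real s)\<^sup>2"
    unfolding power2_eq_square[of "sum _ _"] sum_product
    by (subst sum_distrib_left, rule sum.cong[OF refl], subst sum_distrib_left, rule sum.cong[OF refl]) (simp only: mult_ac)
  also have "\<dots> \<le> ?c * (3 * real \<tau>)"
    using contraction_bounds by (intro mult_left_mono harmonic_sum_square_le) auto
  finally show ?thesis by (simp add: mult_ac)
qed

text \<open>The induction splits off the first summand: the others form the shorter sum evaluated at
  \<open>T x\<close>, whose second moment is unchanged by invariance. Only covariances with time 0
  are then needed.\<close>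

lemma variance_birkhoff_sum:
  "(\<integral>x. ((\<Sum>k<N. trunc \<tau> ((T ^^ k) x)) - real N * integral\<^sup>L M (trunc \<tau>))\<^sup>2 \<partial>M)
    \<le> 52 * (real m)\<^sup>2 * real N * real \<tau>"
proof -
  define \<mu> where "\<mu> = integral\<^sup>L M (trunc \<tau>)"
  define Y where "Y k x = trunc \<tau> ((T ^^ k) x) - \<mu>" for k x
  have [measurable]: "Y k \<in> borel_measurable borel" for k unfolding Y_def by measurable
  have Yb: "\<bar>Y k x\<bar> \<le> real \<tau> + \<bar>\<mu>\<bar>" for k x
    using trunc_bounds[of \<tau> "(T ^^ k) x"] unfolding Y_def by linarith
  have YY: "integrable M (\<lambda>x. Y j x * Y k x)" for j k
    by (rule integrable_M[of _ "(real \<tau> + \<bar>\<mu>\<bar>) * (real \<tau> + \<bar>\<mu>\<bar>)"])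
      (use Yb in \<open>auto simp: abs_mult intro!: mult_mono\<close>)
  have tt: "integrable M (\<lambda>x. trunc \<tau> ((T ^^ j) x) * trunc \<tau> ((T ^^ k) x))" for j k
    by (rule integrable_M[of _ "real \<tau> * real \<tau>"])
      (use trunc_bounds in \<open>auto simp: abs_mult intro!: mult_mono\<close>)
  have t1: "integrable M (\<lambda>x. trunc \<tau> ((T ^^ k) x))" for k
    by (rule integrable_M[of _ "real \<tau>"]) (use trunc_bounds in auto)
  have E1: "(\<integral>x. trunc \<tau> ((T ^^ k) x) \<partial>M) = \<mu>" for k
    unfolding \<mu>_def by (rule integral_T_pow) measurable
  have EYY: "(\<integral>x. Y j x * Y k x \<partial>M) = (\<integral>x. trunc \<tau> ((T ^^ j) x) * trunc \<tau> ((T ^^ k) x) \<partial>M) - \<mu>\<^sup>2" for j k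
  proof -
    have "(\<integral>x. Y j x * Y k x \<partial>M) = (\<integral>x. trunc \<tau> ((T ^^ j) x) * trunc \<tau> ((T ^^ k) x)
        - (\<mu> * trunc \<tau> ((T ^^ j) x) + \<mu> * trunc \<tau> ((T ^^ k) x)) + \<mu>\<^sup>2 \<partial>M)"
      unfolding Y_def by (rule Bochner_Integration.integral_cong) (auto simp: algebra_simps power2_eq_square)
    also have "\<dots> = (\<integral>x. trunc \<tau> ((T ^^ j) x) * trunc \<tau> ((T ^^ k) x) \<partial>M) - (\<mu> * \<mu> + \<mu> * \<mu>) + \<mu>\<^sup>2"
      using tt t1 by (simp add: E1)
    finally show ?thesis by (simp add: power2_eq_square)
  qed
  have diag: "(\<integral>x. Y 0 x * Y 0 x \<partial>M) \<le> 4 * (real m)\<^sup>2 * real \<tau>"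
  proof -
    have "(\<integral>x. Y 0 x * Y 0 x \<partial>M) \<le> 4 * real m * real \<tau>"
    proof -
      have "(\<integral>x. Y 0 x * Y 0 x \<partial>M) = (\<integral>x. (trunc \<tau> x)\<^sup>2 \<partial>M) - \<mu>\<^sup>2"
        unfolding EYY by (simp add: power2_eq_square)
      then show ?thesis using integral_trunc_square[of \<tau>] zero_le_power2[of \<mu>] by linarith
    qed
    also have "\<dots> \<le> 4 * (real m)\<^sup>2 * real \<tau>"
      \<comment> \<open>Weakening m to m^2 gives the diagonal the same shape as the covariance
        bound.\<close>
      using m_pos by (intro mult_right_mono) (auto simp: power2_eq_square)
    finally show ?thesis .
  qed
  have cov: "(\<integral>x. Y 0 x * Y (Suc d) x \<partial>M) \<le> 12 * (real m)\<^sup>2 * real \<tau> * contraction ^ d" for d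
    using covariance_trunc[of \<tau> d] EYY[of 0 "Suc d"] by (simp add: \<mu>_def del: funpow.simps(2))
  have geom: "(\<Sum>d<N. contraction ^ d) \<le> 2" for N
  proof -
    have "(\<Sum>d<N. contraction ^ d) \<le> (\<Sum>d<N. (1 / 2) ^ d)"
      using contraction_bounds by (intro sum_mono power_mono) auto
    also have "\<dots> \<le> 2" by (subst sum_gp_strict) simp
    finally show ?thesis .
  qed
  have "(\<integral>x. (\<Sum>k<N. Y k x)\<^sup>2 \<partial>M) \<le> 52 * (real m)\<^sup>2 * real N * real \<tau>"
  proof (induction N)
    case (Suc N)
    define Z where "Z x = (\<Sum>k<N. Y k x)" for x
    have [measurable]: "Z \<in> borel_measurable borel" unfolding Z_def by measurable
    have ZT: "(\<Sum>k<N. Y (Suc k) x) = Z (T x)" for x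
      by (simp add: Z_def Y_def funpow_Suc_right del: funpow.simps(2))
    have ZZ: "(\<integral>x. (Z (T x))\<^sup>2 \<partial>M) = (\<integral>x. (Z x)\<^sup>2 \<partial>M)"
      using integral_T_pow[of "\<lambda>x. (Z x)\<^sup>2" 1] by simp
    have intZ: "integrable M (\<lambda>x. (Z (T x))\<^sup>2)"
      unfolding ZT[symmetric] power2_eq_square sum_product
      by (intro Bochner_Integration.integrable_sum YY)
    have "(\<integral>x. (\<Sum>k<Suc N. Y k x)\<^sup>2 \<partial>M) =
        (\<integral>x. Y 0 x * Y 0 x + 2 * (\<Sum>k<N. Y 0 x * Y (Suc k) x) + (Z (T x))\<^sup>2 \<partial>M)"
      unfolding sum.lessThan_Suc_shift ZT[symmetric] sum_distrib_left[symmetric]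
      by (rule Bochner_Integration.integral_cong) (auto simp: power2_eq_square algebra_simps)
    also have "\<dots> = (\<integral>x. Y 0 x * Y 0 x \<partial>M) + 2 * (\<Sum>k<N. \<integral>x. Y 0 x * Y (Suc k) x \<partial>M) + (\<integral>x. (Z x)\<^sup>2 \<partial>M)"
      using YY intZ by (simp add: ZZ)
    \<comment> \<open>Origin of the constant: 52 = 4 + 2 * 12 * 2, from the diagonal, the covariance
      bound and the geometric series.\<close>
    also have "\<dots> \<le> 4 * (real m)\<^sup>2 * real \<tau> + 2 * (12 * (real m)\<^sup>2 * real \<tau> * 2) + 52 * (real m)\<^sup>2 * real N * real \<tau>"
    proof (intro add_mono diag mult_left_mono)
      have "(\<Sum>k<N. \<integral>x. Y 0 x * Y (Suc k) x \<partial>M) \<le> (\<Sum>k<N. 12 * (real m)\<^sup>2 * real \<tau> * contraction ^ k)"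
        by (intro sum_mono cov)
      also have "\<dots> = 12 * (real m)\<^sup>2 * real \<tau> * (\<Sum>k<N. contraction ^ k)"
        by (simp add: sum_distrib_left)
      also have "\<dots> \<le> 12 * (real m)\<^sup>2 * real \<tau> * 2"
        by (intro mult_left_mono geom) auto
      finally show "(\<Sum>k<N. \<integral>x. Y 0 x * Y (Suc k) x \<partial>M) \<le> 12 * (real m)\<^sup>2 * real \<tau> * 2" .
    qed (use Suc in \<open>auto simp: Z_def\<close>)
    finally show ?case by (simp add: algebra_simps)
  qed simp
  then show ?thesis by (simp add: Y_def sum_subtractf \<mu>_def)
qed

section \<open>The mean of a truncated digit\<close>

lemma integral_exceeds_small: "s \<le> m \<Longrightarrow> integral\<^sup>L M (exceeds s) = 1"
proof -
  assume "s \<le> m"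
  then have "integral\<^sup>L M (exceeds s) = (\<integral>x. 1 \<partial>M)"
    unfolding integral_exceeds
    by (intro integral_cong_AE AE_mp[OF AE_M_range AE_I2]) (auto simp: weight_tail_0)
  then show ?thesis by simp
qed

text \<open>Up to a null set, the digit reaches s on an initial interval with right end 1 /
  (\<theta> s); \<open>m \<le> s\<close> keeps this point inside the range.\<close>

lemma integral_exceeds_large:
  assumes "m \<le> s" shows "integral\<^sup>L M (exceeds s) = ln (1 + 1 / real s) / \<kappa>"
proof -
  have s: "0 < s" using assms m_pos by simp
  define a where "a = 1 / (\<theta> * real s)"
  have "1 / (\<theta> * real s) \<le> 1 / (\<theta> * real m)"
    using assms m_pos theta_pos s by (intro divide_left_mono mult_left_mono mult_pos_pos) auto
  then have a: "0 \<le> a" "a \<le> \<theta>" using theta_pos by (auto simp: a_def m_theta)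
  have "integral\<^sup>L M (exceeds s) = (\<integral>x. indicator {0..a} x \<partial>M)"
  proof (rule integral_cong_AE)
    have "exceeds s x = indicator {0..a} x" if "x \<in> {0<..<\<theta>}" for x
    proof -
      have "int s \<le> first_digit x \<longleftrightarrow> real s \<le> 1 / (\<theta> * x)"
        by (simp add: first_digit_def le_floor_iff)
      also have "\<dots> \<longleftrightarrow> x \<le> a" using that s theta_pos by (simp add: a_def field_simps)
      finally show ?thesis using that by (auto simp: exceeds_def indicator_def)
    qed
    then show "AE x in M. exceeds s x = indicator {0..a} x"
      by (intro AE_mp[OF AE_M_range_open AE_I2]) blast
  qed auto
  also have "\<dots> = measure M {0..a}" by simp
  also have "\<dots> = ln (1 + \<theta> * a) / \<kappa>"
    using emeasure_M_Icc[OF a] kappa_pos a theta_pos by (simp add: measure_def)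
  also have "\<theta> * a = 1 / real s" using theta_pos by (simp add: a_def)
  finally show ?thesis .
qed

text \<open>The first m tails equal 1, and the later ones, ln ((s + 1) / s) / \<kappa>, telescope.
  The coefficient 1 / \<kappa> of the logarithm becomes the limit in the theorem.\<close>

lemma integral_trunc_eq:
  assumes "m \<le> \<tau>"
  shows "integral\<^sup>L M (trunc \<tau>) = real m + (ln (real \<tau> + 1) - ln (real m + 1)) / \<kappa>"
  using assms
proof (induction \<tau> rule: dec_induct)
  case base
  show ?case by (simp add: integral_trunc integral_exceeds_small)
next
  case (step n)
  have n: "0 < n" using step m_pos by simp
  have "1 + 1 / real (Suc n) = (real n + 2) / (real n + 1)" by (simp add: field_simps)
  then have "integral\<^sup>L M (exceeds (Suc n)) = (ln (real n + 2) - ln (real n + 1)) / \<kappa>"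
    using integral_exceeds_large[of "Suc n"] step by (simp add: ln_div)
  then show ?case using step.IH by (simp add: integral_trunc diff_divide_distrib add_ac)
qed

section \<open>Almost sure behaviour along the blocks\<close>

definition trunc_sum :: "nat \<Rightarrow> nat \<Rightarrow> real \<Rightarrow> real" where
  "trunc_sum \<tau> n x = (\<Sum>k<n. trunc \<tau> ((T ^^ k) x))"

lemma trunc_sum_bounds: "0 \<le> trunc_sum \<tau> n x" "trunc_sum \<tau> n x \<le> real n * real \<tau>"
proof -
  show "0 \<le> trunc_sum \<tau> n x" unfolding trunc_sum_def by (intro sum_nonneg trunc_bounds)
  show "trunc_sum \<tau> n x \<le> real n * real \<tau>"
    unfolding trunc_sum_def
    using sum_mono[of "{..<n}" "\<lambda>k. trunc \<tau> ((T ^^ k) x)" "\<lambda>_. real \<tau>"] trunc_bounds by simp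
qed

lemma trunc_sum_mono: "n \<le> n' \<Longrightarrow> trunc_sum \<tau> n x \<le> trunc_sum \<tau> n' x"
  unfolding trunc_sum_def by (intro sum_mono2 trunc_bounds) auto

lemma measurable_trunc_sum [measurable]: "trunc_sum \<tau> n \<in> borel_measurable borel"
  unfolding trunc_sum_def[abs_def] by measurable

text \<open>The squared normalised deviations have summable integrals by the variance bound. The
  length K is kept free because both ends of a block are needed with the same truncation
  level.\<close>

lemma AE_trunc_sum_centered:
  assumes "summable (\<lambda>j. real (K j) * real (\<tau> j) / (g j)\<^sup>2)"
  shows "AE x in M. (\<lambda>j. (trunc_sum (\<tau> j) (K j) x - real (K j) * integral\<^sup>L M (trunc (\<tau> j))) / g j) \<longlonglongrightarrow> 0"
proof -
  define f where "f j x = ((trunc_sum (\<tau> j) (K j) x - real (K j) * integral\<^sup>L M (trunc (\<tau> j))) / g j)\<^sup>2" for j x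
  have [measurable]: "f j \<in> borel_measurable borel" for j unfolding f_def by measurable
  have intf: "integrable M (f j)" for j
  proof (rule integrable_M)
    fix x
    let ?c = "real (K j) * integral\<^sup>L M (trunc (\<tau> j))"
    have "\<bar>trunc_sum (\<tau> j) (K j) x - ?c\<bar> \<le> real (K j) * real (\<tau> j) + \<bar>?c\<bar>"
      using trunc_sum_bounds[of "\<tau> j" "K j" x] by linarith
    then have "(trunc_sum (\<tau> j) (K j) x - ?c)\<^sup>2 \<le> (real (K j) * real (\<tau> j) + \<bar>?c\<bar>)\<^sup>2"
      by (rule power2_le_iff_abs_le[THEN iffD2, rotated]) simp
    then show "\<bar>f j x\<bar> \<le> (real (K j) * real (\<tau> j) + \<bar>?c\<bar>)\<^sup>2 / (g j)\<^sup>2"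
      by (simp add: f_def power_divide divide_right_mono)
  qed measurable
  have sumf: "summable (\<lambda>j. integral\<^sup>L M (f j))"
  proof (rule summable_comparison_test')
    show "summable (\<lambda>j. 52 * (real m)\<^sup>2 * (real (K j) * real (\<tau> j) / (g j)\<^sup>2))"
      by (rule summable_mult) fact
    fix j
    have "integral\<^sup>L M (f j) =
        (\<integral>x. (trunc_sum (\<tau> j) (K j) x - real (K j) * integral\<^sup>L M (trunc (\<tau> j)))\<^sup>2 \<partial>M) / (g j)\<^sup>2"
      unfolding f_def[abs_def] power_divide by simp
    also have "\<dots> \<le> 52 * (real m)\<^sup>2 * real (K j) * real (\<tau> j) / (g j)\<^sup>2"
      unfolding trunc_sum_def by (intro divide_right_mono variance_birkhoff_sum) simp
    finally have "integral\<^sup>L M (f j) \<le> 52 * (real m)\<^sup>2 * (real (K j) * real (\<tau> j) / (g j)\<^sup>2)"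
      by (simp add: mult_ac)
    moreover have "0 \<le> integral\<^sup>L M (f j)" by (rule integral_nonneg_AE) (simp add: f_def)
    ultimately show "norm (integral\<^sup>L M (f j)) \<le> 52 * (real m)\<^sup>2 * (real (K j) * real (\<tau> j) / (g j)\<^sup>2)"
      by simp
  qed
  have "AE x in M. (\<lambda>j. f j x) \<longlonglongrightarrow> 0"
    by (rule AE_tendsto_zero_if_summable_integral[OF intf _ sumf]) (simp add: f_def)
  then show ?thesis
  proof (rule AE_mp, intro AE_I2 impI)
    fix x assume "(\<lambda>j. f j x) \<longlonglongrightarrow> 0"
    from tendsto_real_sqrt[OF this]
    show "(\<lambda>j. (trunc_sum (\<tau> j) (K j) x - real (K j) * integral\<^sup>L M (trunc (\<tau> j))) / g j) \<longlonglongrightarrow> 0"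
      by (simp only: f_def real_sqrt_abs real_sqrt_zero tendsto_rabs_zero_iff)
  qed
qed

lemma integral_exceeds_two_times:
  assumes "0 < \<tau>" "i < k"
  shows "(\<integral>x. exceeds \<tau> ((T ^^ i) x) * exceeds \<tau> ((T ^^ k) x) \<partial>M) \<le> 4 * (real m)\<^sup>2 / (real \<tau>)\<^sup>2"
proof -
  obtain d where k: "k = Suc d + i" using less_imp_Suc_add[OF assms(2)] by (auto simp: add.commute)
  have "(\<integral>x. exceeds \<tau> ((T ^^ i) x) * exceeds \<tau> ((T ^^ k) x) \<partial>M) =
      (\<integral>x. exceeds \<tau> ((T ^^ i) x) * exceeds \<tau> ((T ^^ Suc d) ((T ^^ i) x)) \<partial>M)"
    unfolding k T_pow_add[of "Suc d" i, symmetric] ..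
  also have "\<dots> = (\<integral>x. exceeds \<tau> x * exceeds \<tau> ((T ^^ Suc d) x) \<partial>M)"
    by (rule integral_T_pow[of "\<lambda>x. exceeds \<tau> x * exceeds \<tau> ((T ^^ Suc d) x)"]) measurable
  also have "\<dots> \<le> 4 * (real m)\<^sup>2 / (real \<tau> * real \<tau>)"
    by (rule integral_exceeds_pair) (use assms in auto)
  finally show ?thesis by (simp add: power2_eq_square)
qed

text \<open>The function \<open>f j\<close> counts pairs of times below \<open>K j\<close> at which
  both digits reach \<open>\<tau> j\<close>. Its mean is at most of order K^2 / \<tau>^2, and a
  count that tends to 0 is eventually 0.\<close>

lemma AE_eventually_one_large_digit:
  assumes \<tau>: "\<And>j. 0 < \<tau> j" and sum: "summable (\<lambda>j. (real (K j))\<^sup>2 / (real (\<tau> j))\<^sup>2)"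
  shows "AE x in M. \<forall>\<^sub>F j in sequentially. \<forall>i k. i < k \<longrightarrow> k < K j \<longrightarrow>
    exceeds (\<tau> j) ((T ^^ i) x) = 0 \<or> exceeds (\<tau> j) ((T ^^ k) x) = 0"
proof -
  define I where "I j = {p \<in> {..<K j} \<times> {..<K j}. fst p < snd p}" for j
  define f where "f j x = (\<Sum>p\<in>I j. exceeds (\<tau> j) ((T ^^ fst p) x) * exceeds (\<tau> j) ((T ^^ snd p) x))" for j x
  have fin: "finite (I j)" for j by (simp add: I_def)
  have cardI: "real (card (I j)) \<le> (real (K j))\<^sup>2" for j
  proof -
    have "card (I j) \<le> card ({..<K j} \<times> {..<K j})" unfolding I_def by (intro card_mono) auto
    then have "card (I j) \<le> K j * K j" by simp
    from of_nat_mono[OF this, where 'a = real] show ?thesis by (simp add: power2_eq_square)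
  qed
  have int: "integrable M (\<lambda>x. exceeds t ((T ^^ i) x) * exceeds t ((T ^^ k) x))" for t i k
    by (rule integrable_M[of _ 1]) (use exceeds_bounds in \<open>auto simp: abs_mult intro!: mult_le_one\<close>)
  have f0: "0 \<le> f j x" for j x
    unfolding f_def by (intro sum_nonneg mult_nonneg_nonneg exceeds_bounds)
  have intf: "integrable M (f j)" for j
    unfolding f_def[abs_def] by (rule Bochner_Integration.integrable_sum, rule int)
  moreover have "summable (\<lambda>j. integral\<^sup>L M (f j))"
  proof (rule summable_comparison_test')
    show "summable (\<lambda>j. 4 * (real m)\<^sup>2 * ((real (K j))\<^sup>2 / (real (\<tau> j))\<^sup>2))"
      by (rule summable_mult) fact
    fix j
    have "integral\<^sup>L M (f j) = (\<Sum>p\<in>I j. \<integral>x. exceeds (\<tau> j) ((T ^^ fst p) x) * exceeds (\<tau> j) ((T ^^ snd p) x) \<partial>M)"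
      unfolding f_def[abs_def] by (rule Bochner_Integration.integral_sum, rule int)
    also have "\<dots> \<le> (\<Sum>p\<in>I j. 4 * (real m)\<^sup>2 / (real (\<tau> j))\<^sup>2)"
      by (intro sum_mono integral_exceeds_two_times \<tau>) (simp add: I_def)
    also have "\<dots> = real (card (I j)) * (4 * (real m)\<^sup>2 / (real (\<tau> j))\<^sup>2)" by simp
    also have "\<dots> \<le> (real (K j))\<^sup>2 * (4 * (real m)\<^sup>2 / (real (\<tau> j))\<^sup>2)"
      by (intro mult_right_mono cardI) simp
    finally have "integral\<^sup>L M (f j) \<le> 4 * (real m)\<^sup>2 * ((real (K j))\<^sup>2 / (real (\<tau> j))\<^sup>2)"
      by (simp add: mult_ac)
    moreover have "0 \<le> integral\<^sup>L M (f j)" by (rule integral_nonneg_AE) (simp add: f0)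
    ultimately show "norm (integral\<^sup>L M (f j)) \<le> 4 * (real m)\<^sup>2 * ((real (K j))\<^sup>2 / (real (\<tau> j))\<^sup>2)"
      by simp
  qed
  ultimately have "AE x in M. (\<lambda>j. f j x) \<longlonglongrightarrow> 0"
    by (intro AE_tendsto_zero_if_summable_integral f0)
  then show ?thesis
  proof (rule AE_mp, intro AE_I2 impI)
    fix x assume "(\<lambda>j. f j x) \<longlonglongrightarrow> 0"
    then have "\<forall>\<^sub>F j in sequentially. f j x < 1" by (rule order_tendstoD) simp
    then show "\<forall>\<^sub>F j in sequentially. \<forall>i k. i < k \<longrightarrow> k < K j \<longrightarrow>
      exceeds (\<tau> j) ((T ^^ i) x) = 0 \<or> exceeds (\<tau> j) ((T ^^ k) x) = 0"
    proof eventually_elim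
      case (elim j)
      show ?case
      proof (intro allI impI)
        fix i k assume "i < k" "k < K j"
        then have "(i, k) \<in> I j" by (simp add: I_def)
        then have "exceeds (\<tau> j) ((T ^^ fst (i, k)) x) * exceeds (\<tau> j) ((T ^^ snd (i, k)) x) \<le> f j x"
          unfolding f_def by (rule member_le_sum) (auto simp: fin exceeds_bounds)
        with elim show "exceeds (\<tau> j) ((T ^^ i) x) = 0 \<or> exceeds (\<tau> j) ((T ^^ k) x) = 0"
          by (auto simp: exceeds_def split: if_splits)
      qed
    qed
  qed
qed

lemma mean_trunc_asymp:
  assumes "(\<lambda>j. real (K j) / endpoint j) \<longlonglongrightarrow> 1"
  shows "(\<lambda>j. real (K j) * integral\<^sup>L M (trunc (cutoff j)) / growth j) \<longlonglongrightarrow> 1 / \<kappa>"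
proof -
  \<comment> \<open>The part of the truncated mean that does not depend on the level; division by ln
    \<open>endpoint j\<close> removes it.\<close>
  define c where "c = real m - ln (real m + 1) / \<kappa>"
  have "(\<lambda>j. c / real j powr (9/10)) \<longlonglongrightarrow> 0" by real_asymp
  then have "(\<lambda>j. real (K j) / endpoint j * (c / real j powr (9/10) +
      ln (real (cutoff j) + 1) / real j powr (9/10) / \<kappa>)) \<longlonglongrightarrow> 1 * (0 + 1 / \<kappa>)"
    using kappa_pos by (intro tendsto_mult tendsto_add tendsto_divide cutoff_asymp assms tendsto_const) auto
  moreover have "\<forall>\<^sub>F j in sequentially. m \<le> cutoff j"
    using cutoff_at_top by (simp add: filterlim_at_top)
  then have "\<forall>\<^sub>F j in sequentially. real (K j) / endpoint j * (c / real j powr (9/10) +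
      ln (real (cutoff j) + 1) / real j powr (9/10) / \<kappa>) =
      real (K j) * integral\<^sup>L M (trunc (cutoff j)) / growth j"
  proof eventually_elim
    case (elim j)
    have "integral\<^sup>L M (trunc (cutoff j)) = c + ln (real (cutoff j) + 1) / \<kappa>"
      unfolding c_def integral_trunc_eq[OF elim] by (simp add: diff_divide_distrib)
    then have "c / real j powr (9/10) + ln (real (cutoff j) + 1) / real j powr (9/10) / \<kappa> =
        integral\<^sup>L M (trunc (cutoff j)) / real j powr (9/10)"
      by (simp only: add_divide_distrib divide_divide_eq_left mult.commute)
    then show ?case by (simp only: growth_def times_divide_times_eq)
  qed
  ultimately show ?thesis by (simp add: tendsto_cong)
qed

lemma AE_trunc_sum_asymp:
  assumes "(\<lambda>j. real (K j) / endpoint j) \<longlonglongrightarrow> 1"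
    and "summable (\<lambda>j. real (K j) * real (cutoff j) / (growth j)\<^sup>2)"
  shows "AE x in M. (\<lambda>j. trunc_sum (cutoff j) (K j) x / growth j) \<longlonglongrightarrow> 1 / \<kappa>"
  using AE_trunc_sum_centered[OF assms(2)]
proof (rule AE_mp, intro AE_I2 impI)
  fix x assume "(\<lambda>j. (trunc_sum (cutoff j) (K j) x -
    real (K j) * integral\<^sup>L M (trunc (cutoff j))) / growth j) \<longlonglongrightarrow> 0"
  from tendsto_add[OF this mean_trunc_asymp[OF assms(1)]]
  show "(\<lambda>j. trunc_sum (cutoff j) (K j) x / growth j) \<longlonglongrightarrow> 1 / \<kappa>"
    by (simp add: diff_divide_distrib)
qed

subsection \<open>Sums without the largest digit\<close>

lemma S_theta_eq: "S_theta \<theta> n x = (\<Sum>k<n. real_of_int (first_digit ((T ^^ k) x)))"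
  unfolding S_theta_def digit_def first_digit_def
  by (rule sum.reindex_bij_witness[of _ Suc "\<lambda>k. k - 1"]) auto

lemma L_theta_eq:
  assumes "0 < n"
  shows "L_theta \<theta> n x = Max ((\<lambda>k. real_of_int (first_digit ((T ^^ k) x))) ` {..<n})"
proof -
  have "(\<lambda>k. digit \<theta> k x) ` {1..n} = (\<lambda>k. first_digit ((T ^^ k) x)) ` {..<n}"
  proof -
    have "{1..n} = Suc ` {..<n}" by (simp add: image_Suc_lessThan)
    then show ?thesis by (simp add: image_image digit_def first_digit_def)
  qed
  moreover have "real_of_int (Max ((\<lambda>k. first_digit ((T ^^ k) x)) ` {..<n})) =
      Max (real_of_int ` (\<lambda>k. first_digit ((T ^^ k) x)) ` {..<n})"
    using assms by (intro mono_Max_commute) (auto simp: mono_def)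
  ultimately show ?thesis by (simp add: L_theta_def image_image)
qed

text \<open>The truncated sum exceeds the trimmed sum by exactly the truncated maximum, which lies
  between 0 and t.\<close>

lemma S_minus_L_bounds:
  assumes x: "x \<in> {0..\<theta>}" and n: "0 < n"
    and one: "\<And>i k. i < k \<Longrightarrow> k < n \<Longrightarrow> exceeds t ((T ^^ i) x) = 0 \<or> exceeds t ((T ^^ k) x) = 0"
  shows "trunc_sum t n x - real t \<le> S_theta \<theta> n x - L_theta \<theta> n x"
    and "S_theta \<theta> n x - L_theta \<theta> n x \<le> trunc_sum t n x"
proof -
  define X where "X k = real_of_int (first_digit ((T ^^ k) x))" for k
  have X0: "0 \<le> X k" for k
    using first_digit_nonneg T_pow_range[OF x, of k] by (simp add: X_def)
  have "X i < real t \<or> X k < real t" if "i < k" "k < n" for i k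
    using one[OF that] by (auto simp: exceeds_def X_def not_le split: if_splits)
  then have eq: "(\<Sum>k<n. X k) - Max (X ` {..<n}) =
      (\<Sum>k<n. min (X k) (real t)) - min (Max (X ` {..<n})) (real t)"
    using n by (intro sum_diff_Max_eq) auto
  have "trunc_sum t n x = (\<Sum>k<n. min (X k) (real t))"
    unfolding trunc_sum_def X_def by (intro sum.cong trunc_eq_min) (use T_pow_range[OF x] in auto)
  moreover have "S_theta \<theta> n x = (\<Sum>k<n. X k)" "L_theta \<theta> n x = Max (X ` {..<n})"
    using L_theta_eq[OF n, of x] S_theta_eq[of n x] by (simp_all add: X_def)
  moreover have "0 \<le> Max (X ` {..<n})"
  proof -
    have "X 0 \<le> Max (X ` {..<n})" using n by (intro Max_ge) auto
    then show ?thesis using X0[of 0] by linarith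
  qed
  ultimately show "trunc_sum t n x - real t \<le> S_theta \<theta> n x - L_theta \<theta> n x"
    and "S_theta \<theta> n x - L_theta \<theta> n x \<le> trunc_sum t n x"
    using eq by auto
qed

lemma S_minus_L_tendsto:
  assumes x: "x \<in> {0..\<theta>}"
    and lim: "(\<lambda>j. trunc_sum (cutoff j) (block j) x / growth j) \<longlonglongrightarrow> 1 / \<kappa>"
      "(\<lambda>j. trunc_sum (cutoff j) (block (Suc j)) x / growth j) \<longlonglongrightarrow> 1 / \<kappa>"
    and one: "\<forall>\<^sub>F j in sequentially. \<forall>i k. i < k \<longrightarrow> k < block (Suc j) \<longrightarrow>
      exceeds (cutoff j) ((T ^^ i) x) = 0 \<or> exceeds (cutoff j) ((T ^^ k) x) = 0"
  shows "(\<lambda>n. (S_theta \<theta> n x - L_theta \<theta> n x) / (real n * ln (real n))) \<longlonglongrightarrow> 1 / \<kappa>"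
proof -
  \<comment> \<open>Numerator from one end of the block and denominator from the other, so that
    monotonicity in n gives bounds valid for every n inside.\<close>
  define lo where "lo j = (trunc_sum (cutoff j) (block j) x - real (cutoff j)) /
    (real (block (Suc j)) * ln (real (block (Suc j))))" for j
  define hi where "hi j = trunc_sum (cutoff j) (block (Suc j)) x / (real (block j) * ln (real (block j)))" for j
  define r where "r n = (S_theta \<theta> n x - L_theta \<theta> n x) / (real n * ln (real n))" for n
  have g: "\<forall>\<^sub>F j in sequentially. growth j \<noteq> 0"
    using eventually_gt_at_top[of 0] by eventually_elim (simp add: growth_def endpoint_def)
  have lo: "lo \<longlonglongrightarrow> 1 / \<kappa>"
  proof (rule Lim_transform_eventually)
    show "(\<lambda>j. (trunc_sum (cutoff j) (block j) x / growth j - real (cutoff j) / growth j) *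
       (growth j / (real (block (Suc j)) * ln (real (block (Suc j)))))) \<longlonglongrightarrow> 1 / \<kappa>"
      using tendsto_mult[OF tendsto_diff[OF lim(1) cutoff_asymp(2)] block_asymp(4)] by simp
    show "\<forall>\<^sub>F j in sequentially. (trunc_sum (cutoff j) (block j) x / growth j - real (cutoff j) / growth j) *
       (growth j / (real (block (Suc j)) * ln (real (block (Suc j))))) = lo j"
      using g by eventually_elim (simp add: lo_def diff_divide_distrib[symmetric])
  qed
  have hi: "hi \<longlonglongrightarrow> 1 / \<kappa>"
  proof (rule Lim_transform_eventually)
    show "(\<lambda>j. trunc_sum (cutoff j) (block (Suc j)) x / growth j *
       (growth j / (real (block j) * ln (real (block j))))) \<longlonglongrightarrow> 1 / \<kappa>"
      using tendsto_mult[OF lim(2) block_asymp(3)] by simp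
    show "\<forall>\<^sub>F j in sequentially. trunc_sum (cutoff j) (block (Suc j)) x / growth j *
       (growth j / (real (block j) * ln (real (block j)))) = hi j"
      using g by eventually_elim (simp add: hi_def)
  qed
  \<comment> \<open>Positivity is needed for the lower bound: enlarging the denominator under a
    negative numerator would reverse the inequality.\<close>
  have "\<forall>\<^sub>F j in sequentially. 0 < lo j"
    by (rule order_tendstoD(1)[OF lo]) (use kappa_pos in simp)
  moreover have "\<forall>\<^sub>F j in sequentially. 2 \<le> block j"
    using block_at_top by (simp add: filterlim_at_top)
  ultimately have between: "\<forall>\<^sub>F j in sequentially. \<forall>n. block j \<le> n \<longrightarrow> n < block (Suc j) \<longrightarrow>
      lo j \<le> r n \<and> r n \<le> hi j"
    using one
  proof eventually_elim
    case (elim j)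
    show ?case
    proof (intro allI impI)
      fix n assume n: "block j \<le> n" "n < block (Suc j)"
      let ?D = "S_theta \<theta> n x - L_theta \<theta> n x"
      have n2: "2 \<le> n" using n elim by simp
      have b: "trunc_sum (cutoff j) n x - real (cutoff j) \<le> ?D" "?D \<le> trunc_sum (cutoff j) n x"
        using S_minus_L_bounds[OF x, of n "cutoff j"] n2 n elim by auto
      have pos: "0 < real (block j) * ln (real (block j))" using elim by simp
      have posn: "0 < real n * ln (real n)" using n2 by simp
      have le: "real (block j) * ln (real (block j)) \<le> real n * ln (real n)"
        "real n * ln (real n) \<le> real (block (Suc j)) * ln (real (block (Suc j)))"
        using n n2 elim by (auto intro!: mult_mono)
      have num: "0 \<le> trunc_sum (cutoff j) (block j) x - real (cutoff j)"
        using elim(1) le posn by (auto simp: lo_def zero_less_divide_iff)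
      have "lo j \<le> (trunc_sum (cutoff j) (block j) x - real (cutoff j)) / (real n * ln (real n))"
        unfolding lo_def
        by (rule divide_left_mono[OF le(2) num mult_pos_pos]) (use le posn in linarith)+
      also have "\<dots> \<le> r n"
        unfolding r_def using b trunc_sum_mono[OF n(1), of "cutoff j" x] posn
        by (intro divide_right_mono) auto
      finally have "lo j \<le> r n" .
      moreover have "r n \<le> trunc_sum (cutoff j) (block (Suc j)) x / (real n * ln (real n))"
        unfolding r_def using b trunc_sum_mono[of n "block (Suc j)" "cutoff j" x] n posn
        by (intro divide_right_mono) auto
      moreover have "\<dots> \<le> hi j"
        unfolding hi_def
        by (rule divide_left_mono[OF le(1) trunc_sum_bounds(1) mult_pos_pos[OF posn pos]])
      ultimately show "lo j \<le> r n \<and> r n \<le> hi j" by simp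
    qed
  qed
  \<comment> \<open>The block containing n; the value at n = 0, which lies in no block, is
    arbitrary.\<close>
  define idx where "idx n = (SOME j. block j \<le> n \<and> n < block (Suc j))" for n
  have idx: "block (idx n) \<le> n \<and> n < block (Suc (idx n))" if "1 \<le> n" for n
    unfolding idx_def using ex_block[OF that] by (rule someI2_ex[of "\<lambda>j. block j \<le> n \<and> n < block (Suc j)"]) blast
  have idx_top: "filterlim idx at_top sequentially"
    unfolding filterlim_at_top
  proof
    fix J
    show "\<forall>\<^sub>F n in sequentially. J \<le> idx n"
      using eventually_ge_at_top[of "max 1 (block J)"]
    proof eventually_elim
      case (elim n)
      have "block J < block (Suc (idx n))" using idx[of n] elim by simp
      then have "J < Suc (idx n)" using monoD[OF mono_block, of "Suc (idx n)" J] by (meson not_le)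
      then show ?case by simp
    qed
  qed
  have "\<forall>\<^sub>F n in sequentially. lo (idx n) \<le> r n \<and> r n \<le> hi (idx n)"
    using eventually_compose_filterlim[OF between idx_top] eventually_ge_at_top[of 1]
    by eventually_elim (use idx in blast)
  then have "r \<longlonglongrightarrow> 1 / \<kappa>"
    by (intro tendsto_sandwich[OF _ _ filterlim_compose[OF lo idx_top] filterlim_compose[OF hi idx_top]])
      (auto elim: eventually_mono)
  then show ?thesis by (simp add: r_def[abs_def])
qed

lemma AE_S_minus_L:
  "AE x in M. (\<lambda>n. (S_theta \<theta> n x - L_theta \<theta> n x) / (real n * ln (real n))) \<longlonglongrightarrow> 1 / \<kappa>"
proof -
  have "AE x in M. \<forall>\<^sub>F j in sequentially. \<forall>i k. i < k \<longrightarrow> k < block (Suc j) \<longrightarrow>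
      exceeds (cutoff j) ((T ^^ i) x) = 0 \<or> exceeds (cutoff j) ((T ^^ k) x) = 0"
    by (rule AE_eventually_one_large_digit[OF _ summable_variance_bounds(3)]) (simp add: cutoff_def)
  then show ?thesis
    using AE_M_range AE_trunc_sum_asymp[OF block_asymp(1) summable_variance_bounds(1)]
      AE_trunc_sum_asymp[OF block_asymp(2) summable_variance_bounds(2)]
    by eventually_elim (rule S_minus_L_tendsto)
qed

end

theorem theorem1p4:
  fixes \<theta> :: real
  assumes "0 < \<theta>" and "\<theta> < 1" and "\<theta> \<notin> \<rat>"
    and "\<exists>m::nat. m > 0 \<and> \<theta>\<^sup>2 = 1 / real m"
  shows "AE x in gamma_theta \<theta>.
    ((\<lambda>n. (S_theta \<theta> n x - L_theta \<theta> n x) / (real n * ln (real n)))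
      \<longlonglongrightarrow> 1 / ln (1 + \<theta>\<^sup>2))"
proof -
  obtain m :: nat where "0 < m" "\<theta>\<^sup>2 = 1 / real m" using assms(4) by blast
  then interpret theta_expansion \<theta> m using assms(1) by unfold_locales
  show ?thesis using AE_S_minus_L by (simp add: \<kappa>_def)
qed

end
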